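(* Let $C$ be an extreme point of $\operatorname{Cor}(m,n)$ and let $r=\operatorname{rank}(C)$. The minimum local dimension of a tensor operator representation of $C$ is $2^{\lfloor r/2\rfloor}$.
   Context: $\operatorname{Cor}(m,n)$ denotes the (convex) set of all bipartite correlation matrices of size $m\times n$, i.e., matrices $C\in\mathbb{R}^{m\times n}$ for which there exist real unit vectors $x_1,\ldots,x_m,y_1,\ldots,y_n\in\mathbb{R}^{d'}$ (for some $d'\ge1$) with $C_{s,t}=\langle x_s,y_t\rangle$ for all $s\in\{1,\ldots,m\}$, $t\in\{1,\ldots,n\}$. A tensor operator representation of $C\in\mathbb{R}^{m\times n}$ in local dimension $d$ consists of a unit vector $\psi\in\mathbb{C}^d\otimes\mathbb{C}^d$ and Hermitian $d\times d$ matrices $X_1,\ldots,X_m$ and $Y_1,\ldots,Y_n$ with spectra contained in $[-1,1]$, such that $C_{s,t}=\psi^*(X_s\otimes Y_t)\psi$ for all $s\in\{1,\ldots,m\}$ and $t\in\{1,\ldots,n\}$. *)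

theory Defs
  imports "HOL-Analysis.Analysis" "Jordan_Normal_Form.Spectral_Radius"
begin

no_notation vec_index (infixl "$" 100)

text \<open>The sizes m and n are the index types \<^typ>\<open>'m\<close> and \<^typ>\<open>'n\<close>. Dimensions that are quantified
  over (d' and the local dimension d) are natural numbers, with vectors and matrices taken from
  \<^const>\<open>carrier_vec\<close> and \<^const>\<open>carrier_mat\<close>.\<close>

definition Cor :: "(real ^ 'n ^ 'm) set" where
  "Cor = {C. \<exists>(d'::nat) (x :: 'm \<Rightarrow> real vec) (y :: 'n \<Rightarrow> real vec).
      d' \<ge> 1 \<and>
      (\<forall>s. x s \<in> carrier_vec d' \<and> x s \<bullet> x s = 1) \<and>
      (\<forall>t. y t \<in> carrier_vec d' \<and> y t \<bullet> y t = 1) \<and>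
      (\<forall>s t. C $ s $ t = x s \<bullet> y t)}"

definition kronecker :: "'a::times mat \<Rightarrow> 'a mat \<Rightarrow> 'a mat"  (infixl \<open>\<otimes>\<^sub>K\<close> 70) where
  "A \<otimes>\<^sub>K B = mat (dim_row A * dim_row B) (dim_col A * dim_col B)
      (\<lambda>(i, j). A $$ (i div dim_row B, j div dim_col B) * B $$ (i mod dim_row B, j mod dim_col B))"

definition hermitian :: "complex mat \<Rightarrow> bool" where
  "hermitian A \<longleftrightarrow> mat_adjoint A = A"

text \<open>The tensor product of two copies of d-dimensional complex space is the space of vectors of
  dimension \<open>d * d\<close>, where coordinate \<open>i * d + j\<close> belongs to the tensor product of the i-th and j-th
  basis vectors. Since \<open>v \<bullet>c w\<close> is conjugate linear in its second argument, \<open>\<psi>\<^sup>* M \<psi>\<close> is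
  \<open>(M *\<^sub>v \<psi>) \<bullet>c \<psi>\<close>.\<close>

definition tensor_operator_rep ::
  "nat \<Rightarrow> real ^ 'n ^ 'm \<Rightarrow> complex vec \<Rightarrow> ('m \<Rightarrow> complex mat) \<Rightarrow> ('n \<Rightarrow> complex mat) \<Rightarrow> bool" where
  "tensor_operator_rep d C \<psi> X Y \<longleftrightarrow>
      \<psi> \<in> carrier_vec (d * d) \<and> \<psi> \<bullet>c \<psi> = 1 \<and>
      (\<forall>s. X s \<in> carrier_mat d d \<and> hermitian (X s) \<and> spectrum (X s) \<subseteq> complex_of_real ` {-1..1}) \<and>
      (\<forall>t. Y t \<in> carrier_mat d d \<and> hermitian (Y t) \<and> spectrum (Y t) \<subseteq> complex_of_real ` {-1..1}) \<and>
      (\<forall>s t. complex_of_real (C $ s $ t) = ((X s \<otimes>\<^sub>K Y t) *\<^sub>v \<psi>) \<bullet>c \<psi>)"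

end

theory Submission
  imports Defs "HOL-Real_Asymp.Real_Asymp"
begin

text \<open>
  Both halves rest on the rigidity of vector systems that realise an extreme point \<open>C\<close> of
  \<^const>\<open>Cor\<close>. Any decomposition \<open>C = P + N\<close> into Gram blocks of vectors with squared norms at most
  \<open>p\<close> and \<open>1 - p\<close> forces \<open>P = p C\<close> (\<open>extreme_split\<close>). Perturbing the vectors of a realisation
  \<open>C s t = inner (x s) (y t)\<close> therefore shows that all of them are unit vectors, that the \<open>x s\<close>
  and the \<open>y t\<close> span the same space, and that this space has dimension \<open>r = rank C\<close>. It has an
  orthonormal basis \<open>u i\<close>, \<open>i < r\<close>, whose members are combinations of the \<open>x s\<close> as well as of
  the \<open>y t\<close> (\<open>orthonormal_frame\<close>).

  Upper bound. Represent the coordinate vectors of \<open>x s\<close> and \<open>y t\<close> in that basis by the linear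
  combinations of \<open>r\<close> anticommuting Hermitian involutions; such involutions exist in dimension
  \<open>2 ^ (r div 2)\<close> (\<open>clifford_generators\<close>, built from Pauli matrices). A unit vector becomes an
  involution, the normalised trace of a product is the inner product of the vectors, and the
  maximally entangled state turns \<open>\<psi>\<^sup>* (X \<otimes> Y\<^sup>T) \<psi>\<close> into that normalised trace.

  Lower bound. In a tensor operator representation the vectors \<open>(X s \<otimes> 1) \<psi>\<close> and \<open>(1 \<otimes> Y t) \<psi>\<close>
  form a realisation of \<open>C\<close> in a real inner product space. Let \<open>A i\<close> be the combination of the
  \<open>X s\<close> that sends \<open>\<psi>\<close> to \<open>u i\<close>. The central point is that the \<open>A i\<close> satisfy the Clifford
  relations on \<open>\<psi>\<close> (\<open>clifford_relations\<close>): for two operators \<open>R t\<close>, \<open>R t'\<close> on the second factor,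
  the vectors obtained by applying \<open>R t + R t'\<close> and \<open>R t - R t'\<close> to a realisation split \<open>C\<close> in the
  sense above, and this determines the anticommutators. The relations propagate from \<open>\<psi>\<close> to a
  nonzero complex subspace of the \<open>d\<close>-dimensional first factor. Splitting it repeatedly into the two eigenspaces
  of \<open>\<i> A i A j\<close>, which \<open>A i\<close> exchanges, doubles the dimension for each pair of generators
  (\<open>clifford_orthogonal_family\<close>), whence \<open>2 ^ (r div 2) \<le> d\<close>.

  Vectors of varying dimension are placed in one real inner product space, the finitely supported
  complex functions with the real part of the Hermitian product. The geometric arguments are
  stated for arbitrary real inner product spaces.
\<close>

hide_const (open) Matrix.orthogonal VectorSpace.subspace
hide_fact (open) Matrix.orthogonal_def VectorSpace.subspace_def

section \<open>Orthonormal bases of finitely generated subspaces\<close>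

lemma finite_orthonormal_basis:
  fixes S :: "'a::real_inner set"
  assumes "finite S"
  obtains u :: "nat \<Rightarrow> 'a" where "\<And>i. i < dim S \<Longrightarrow> u i \<in> span S"
    and "\<And>i j. i < dim S \<Longrightarrow> j < dim S \<Longrightarrow> inner (u i) (u j) = (if i = j then 1 else 0)"
    and "\<And>v. v \<in> span S \<Longrightarrow> v = (\<Sum>i<dim S. inner v (u i) *\<^sub>R u i)"
proof -
  obtain C where C: "finite C" "span C = span S" "pairwise orthogonal C"
    using basis_orthogonal[OF assms] by blast
  define B where "B = (\<lambda>x. x /\<^sub>R norm x) ` (C - {0})"
  have fB: "finite B" using C by (simp add: B_def)
  have spC: "span (C - {0}) = span S" using C(2) by (metis span_insert_0 insert_Diff_single)
  have spB: "span B = span S"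
  proof -
    have 1: "span B \<subseteq> span S"
      unfolding spC[symmetric] by (rule span_minimal) (auto simp: B_def intro: span_scale span_base)
    have "C - {0} \<subseteq> span B"
    proof
      fix x assume x: "x \<in> C - {0}"
      have "norm x *\<^sub>R (x /\<^sub>R norm x) \<in> span B"
        by (rule span_scale, rule span_base) (use x in \<open>auto simp: B_def\<close>)
      then show "x \<in> span B" using x by simp
    qed
    then have "span (C - {0}) \<subseteq> span B"
      by (intro span_minimal subspace_span)
    with 1 show ?thesis unfolding spC[symmetric] by (rule subset_antisym)
  qed
  have nB: "norm b = 1" if "b \<in> B" for b
    using that unfolding B_def by (rule imageE) simp
  have oB: "pairwise orthogonal B"
  proof (rule pairwiseI)
    fix b c assume "b \<in> B" "c \<in> B" "b \<noteq> c"
    then obtain z w where "z \<in> C" "w \<in> C" "b = z /\<^sub>R norm z" "c = w /\<^sub>R norm w"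
      unfolding B_def by blast
    moreover from this \<open>b \<noteq> c\<close> have "orthogonal z w"
      using C(3) by (auto simp: pairwise_def)
    ultimately show "orthogonal b c" by (simp add: orthogonal_def)
  qed
  have indB: "independent B"
    by (rule pairwise_orthogonal_independent[OF oB]) (use nB in force)
  have cB: "card B = dim S" using dim_eq_card[OF spB indB] by simp
  obtain u where u: "bij_betw u {..<dim S} B"
    using ex_bij_betw_nat_finite[OF fB] cB by (auto simp: atLeast0LessThan)
  have uB: "u i \<in> B" if "i < dim S" for i using u that by (auto simp: bij_betw_def)
  have ip: "inner (u i) (u j) = (if i = j then 1 else 0)" if "i < dim S" "j < dim S" for i j
  proof (cases "i = j")
    case True then show ?thesis using nB[OF uB[OF that(1)]] by (simp add: norm_eq_1)
  next
    case False
    then have "u i \<noteq> u j" using u that by (auto simp: bij_betw_def inj_on_def)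
    then show ?thesis using oB uB[OF that(1)] uB[OF that(2)] False by (auto simp: pairwise_def orthogonal_def)
  qed
  have ex: "v = (\<Sum>i<dim S. inner v (u i) *\<^sub>R u i)" if v: "v \<in> span S" for v
  proof -
    obtain c where "v = (\<Sum>b\<in>B. c b *\<^sub>R b)"
      using v unfolding spB[symmetric] span_finite[OF fB] by auto
    then have c: "v = (\<Sum>i<dim S. c (u i) *\<^sub>R u i)"
      using sum.reindex_bij_betw[OF u, of "\<lambda>b. c b *\<^sub>R b"] by simp
    have "inner v (u j) = c (u j)" if "j < dim S" for j
    proof -
      have "inner v (u j) = (\<Sum>i<dim S. c (u i) * inner (u i) (u j))"
        by (subst c) (simp add: inner_sum_left)
      also have "\<dots> = (\<Sum>i<dim S. if i = j then c (u i) else 0)"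
        using ip[OF _ that] by (intro sum.cong) auto
      finally have "inner v (u j) = (\<Sum>i<dim S. if i = j then c (u i) else 0)" .
      then show ?thesis using that by simp
    qed
    then show ?thesis by (subst c) (auto intro: sum.cong)
  qed
  show thesis
  proof (rule that)
    show "u i \<in> span S" if "i < dim S" for i
      using uB[OF that] spB span_base by blast
  qed (fact ip ex)+
qed

section \<open>Correlation matrices over arbitrary real inner product spaces\<close>

text \<open>Vectors of norm at most one suffice: two further coordinates, one used only by the \<open>x s\<close> and one
  only by the \<open>y t\<close>, complete them to unit vectors and leave the mixed inner products unchanged.
  Coordinates in an orthonormal basis of the span then give vectors of \<^const>\<open>carrier_vec\<close>.\<close>

lemma CorI:
  fixes x :: "'m::finite \<Rightarrow> 'a::real_inner" and y :: "'n::finite \<Rightarrow> 'a" and C :: "real ^ 'n ^ 'm"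
  assumes nx: "\<And>s. norm (x s) \<le> 1" and ny: "\<And>t. norm (y t) \<le> 1"
    and C: "\<And>s t. C $ s $ t = inner (x s) (y t)"
  shows "C \<in> Cor"
proof -
  define x' :: "'m \<Rightarrow> 'a \<times> real \<times> real" where "x' s = (x s, sqrt (1 - (norm (x s))\<^sup>2), 0)" for s
  define y' :: "'n \<Rightarrow> 'a \<times> real \<times> real" where "y' t = (y t, 0, sqrt (1 - (norm (y t))\<^sup>2))" for t
  have x1: "inner (x' s) (x' s) = 1" for s
    using nx[of s] by (simp add: x'_def inner_prod_def power2_norm_eq_inner[symmetric] abs_square_le_1 flip: power2_eq_square)
  have y1: "inner (y' t) (y' t) = 1" for t
    using ny[of t] by (simp add: y'_def inner_prod_def power2_norm_eq_inner[symmetric] abs_square_le_1 flip: power2_eq_square)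
  have xy: "inner (x' s) (y' t) = C $ s $ t" for s t
    by (simp add: x'_def y'_def C inner_prod_def)
  let ?S = "range x' \<union> range y'"
  let ?r = "dim ?S"
  obtain u where "\<And>i. i < ?r \<Longrightarrow> u i \<in> span ?S"
    and u: "\<And>i j. i < ?r \<Longrightarrow> j < ?r \<Longrightarrow> inner (u i) (u j) = (if i = j then 1 else 0)"
    "\<And>v. v \<in> span ?S \<Longrightarrow> v = (\<Sum>i<?r. inner v (u i) *\<^sub>R u i)"
    by (rule finite_orthonormal_basis[of ?S]) (simp, rule that)
  have ip: "inner v w = (\<Sum>i<?r. inner v (u i) * inner w (u i))" if "v \<in> span ?S" for v w
  proof -
    have "inner v w = inner (\<Sum>i<?r. inner v (u i) *\<^sub>R u i) w" using u(2)[OF that] by simp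
    then show ?thesis by (simp only: inner_sum_left inner_scaleR_left inner_commute[of w])
  qed
  have sx: "x' s \<in> span ?S" and sy: "y' t \<in> span ?S" for s t by (auto intro: span_base)
  define X where "X s = Matrix.vec ?r (\<lambda>i. inner (x' s) (u i))" for s
  define Y where "Y t = Matrix.vec ?r (\<lambda>i. inner (y' t) (u i))" for t
  have r: "?r \<ge> 1"
  proof (rule ccontr)
    assume "\<not> ?r \<ge> 1"
    then have "?r = 0" by simp
    then have "x' s = 0" for s using u(2)[OF sx, of s] by simp
    then show False using x1 by simp
  qed
  have "X s \<in> carrier_vec ?r" "Y t \<in> carrier_vec ?r" for s t by (auto simp: X_def Y_def)
  moreover have "scalar_prod (X s) (X s) = 1" for s
    using x1[of s] by (simp add: ip[OF sx, of s "x' s"] X_def scalar_prod_def atLeast0LessThan)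
  moreover have "scalar_prod (Y t) (Y t) = 1" for t
    using y1[of t] by (simp add: ip[OF sy, of t "y' t"] Y_def scalar_prod_def atLeast0LessThan)
  moreover have "C $ s $ t = scalar_prod (X s) (Y t)" for s t
    using xy[of s t] by (simp add: ip[OF sx, of s "y' t"] X_def Y_def scalar_prod_def atLeast0LessThan)
  ultimately show ?thesis unfolding Cor_def using r by blast
qed

lemma transpose_Cor: "transpose ` (Cor :: (real ^ 'n ^ 'm) set) = Cor"
proof -
  have *: "transpose C \<in> Cor" if "C \<in> Cor" for C :: "real ^ 'a ^ 'b"
  proof -
    from that obtain d x y where d: "d \<ge> 1" "\<forall>s. x s \<in> carrier_vec d \<and> scalar_prod (x s) (x s) = 1"
      "\<forall>t. y t \<in> carrier_vec d \<and> scalar_prod (y t) (y t) = 1" "\<forall>s t. C $ s $ t = scalar_prod (x s) (y t)"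
      unfolding Cor_def by blast
    then have "\<forall>t s. transpose C $ t $ s = scalar_prod (y t) (x s)"
      by (simp add: transpose_def) (metis comm_scalar_prod)
    with d show ?thesis unfolding Cor_def by blast
  qed
  show ?thesis
  proof
    show "transpose ` Cor \<subseteq> Cor" by (rule image_subsetI) (rule *)
    show "Cor \<subseteq> transpose ` (Cor :: (real ^ 'n ^ 'm) set)"
    proof
      fix C :: "real ^ 'm ^ 'n"
      assume "C \<in> Cor"
      then show "C \<in> transpose ` Cor"
        by (intro image_eqI[of _ _ "transpose C"] *) simp_all
    qed
  qed
qed

lemma extreme_point_transpose:
  fixes C :: "real ^ 'n ^ 'm"
  assumes "C extreme_point_of Cor"
  shows "transpose C extreme_point_of Cor"
proof -
  have lin: "linear (transpose :: real ^ 'n ^ 'm \<Rightarrow> real ^ 'm ^ 'n)"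
    by (rule linearI) (simp_all add: transpose_def Finite_Cartesian_Product.vec_eq_iff)
  have inj: "inj (transpose :: real ^ 'n ^ 'm \<Rightarrow> real ^ 'm ^ 'n)"
    by (rule inj_on_inverseI[of _ transpose]) simp
  show ?thesis
    using face_of_linear_image[OF lin inj, of "{C}" Cor] assms
    unfolding transpose_Cor image_insert image_empty face_of_singleton by blast
qed

text \<open>Rescaling the two systems by \<open>sqrt p\<close> and \<open>sqrt (1 - p)\<close> exhibits \<open>C\<close> as a convex combination
  of two points of \<^const>\<open>Cor\<close>. The perturbation arguments below all end with this lemma.\<close>

lemma extreme_split:
  fixes x1 :: "'m::finite \<Rightarrow> 'a::real_inner" and y1 :: "'n::finite \<Rightarrow> 'a"
    and x2 :: "'m \<Rightarrow> 'b::real_inner" and y2 :: "'n \<Rightarrow> 'b" and C :: "real ^ 'n ^ 'm"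
  assumes ext: "C extreme_point_of Cor"
    and x1: "\<And>s. inner (x1 s) (x1 s) \<le> p" and y1: "\<And>t. inner (y1 t) (y1 t) \<le> p"
    and x2: "\<And>s. inner (x2 s) (x2 s) \<le> 1 - p" and y2: "\<And>t. inner (y2 t) (y2 t) \<le> 1 - p"
    and C: "\<And>s t. C $ s $ t = inner (x1 s) (y1 t) + inner (x2 s) (y2 t)"
  shows "inner (x1 s) (y1 t) = p * C $ s $ t"
proof -
  have p0: "0 \<le> p" by (rule order_trans[OF inner_ge_zero x1])
  have p1: "p \<le> 1" using x2[of s] inner_ge_zero[of "x2 s"] by linarith
  have zero: "z = 0" if "inner z z \<le> 0" for z :: "'c::real_inner"
    using order_antisym[OF that inner_ge_zero] by simp
  consider "p = 0" | "p = 1" | "0 < p" "p < 1" using p0 p1 by linarith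
  then show ?thesis
  proof cases
    case 1
    then have "x1 s = 0" using x1[of s] by (intro zero) simp
    then show ?thesis using 1 by simp
  next
    case 2
    then have "x2 s = 0" using x2[of s] by (intro zero) simp
    then show ?thesis using 2 C by simp
  next
    case 3
    have scaled: "(\<chi> s t. inner (x s) (y t) / q) \<in> Cor"
      if "0 < q" "\<And>s. inner (x s) (x s) \<le> q" "\<And>t. inner (y t) (y t) \<le> q"
      for q and x :: "'m \<Rightarrow> 'c::real_inner" and y :: "'n \<Rightarrow> 'c"
    proof (rule CorI[where x = "\<lambda>s. x s /\<^sub>R sqrt q" and y = "\<lambda>t. y t /\<^sub>R sqrt q"])
      have *: "norm z \<le> sqrt q" if "inner z z \<le> q" for z :: 'c
        using that by (simp add: norm_eq_sqrt_inner)
      show "norm (x s /\<^sub>R sqrt q) \<le> 1" for s using *[OF that(2)[of s]] that(1) by (simp add: field_simps)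
      show "norm (y s /\<^sub>R sqrt q) \<le> 1" for s using *[OF that(3)[of s]] that(1) by (simp add: field_simps)
      show "(\<chi> s t. inner (x s) (y t) / q) $ s $ t = inner (x s /\<^sub>R sqrt q) (y t /\<^sub>R sqrt q)" for s t
        using that(1) by (simp add: field_simps real_sqrt_mult_self)
    qed
    define C1 :: "real ^ 'n ^ 'm" where "C1 = (\<chi> s t. inner (x1 s) (y1 t) / p)"
    define C2 :: "real ^ 'n ^ 'm" where "C2 = (\<chi> s t. inner (x2 s) (y2 t) / (1 - p))"
    have m: "C1 \<in> Cor" "C2 \<in> Cor"
      unfolding C1_def C2_def using 3 x1 y1 x2 y2 by (auto intro!: scaled)
    have e: "C = (1 - p) *\<^sub>R C2 + p *\<^sub>R C1"
      using 3 by (simp add: Finite_Cartesian_Product.vec_eq_iff C C1_def C2_def)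
    have "C \<notin> open_segment C2 C1" using ext m by (auto simp: extreme_point_of_def)
    then have "C1 = C2" using e 3 by (auto simp: in_segment)
    then have "C = C1" using e by (simp flip: scaleR_left_distrib)
    then have "C $ s $ t = inner (x1 s) (y1 t) / p" by (simp add: C1_def)
    then show ?thesis using 3 by simp
  qed
qed

text \<open>If \<open>x s\<close> were shorter than one, it could be moved both ways along some \<open>y t\<close>. The midpoint of
  the two resulting matrices is \<open>C\<close>, and they differ in the entry at \<open>s\<close> and \<open>t\<close>.\<close>

lemma extreme_norm_if_other_side_unit:
  fixes x :: "'m::finite \<Rightarrow> 'a::real_inner" and y :: "'n::finite \<Rightarrow> 'a" and C :: "real ^ 'n ^ 'm"
  assumes ext: "C extreme_point_of Cor"
    and x: "\<And>s. norm (x s) \<le> 1" and y: "\<And>t. norm (y t) = 1"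
    and C: "\<And>s t. C $ s $ t = inner (x s) (y t)"
  shows "norm (x s) = 1"
proof -
  fix t :: 'n
  define e where "e = 1 - norm (x s)"
  have e0: "e \<ge> 0" using x[of s] by (simp add: e_def)
  define xp where "xp \<sigma> = x(s := x s + (\<sigma> * e) *\<^sub>R y t)" for \<sigma>
  have n: "norm (xp \<sigma> s') \<le> 1" if "\<bar>\<sigma>\<bar> = 1" for \<sigma> s'
  proof -
    have "norm (x s + (\<sigma> * e) *\<^sub>R y t) \<le> norm (x s) + norm ((\<sigma> * e) *\<^sub>R y t)" by (rule norm_triangle_ineq)
    also have "\<dots> = 1" using that y e0 by (simp add: abs_mult) (simp add: e_def)
    finally show ?thesis using x by (simp add: xp_def)
  qed
  have sq: "inner (z /\<^sub>R sqrt 2) (w /\<^sub>R sqrt 2) = inner z w / 2" for z w :: 'a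
    by (simp add: field_simps)
  have half: "inner (z /\<^sub>R sqrt 2) (z /\<^sub>R sqrt 2) \<le> 1 / 2" if "norm z \<le> 1" for z :: 'a
    using that by (simp only: sq) (simp add: dot_square_norm power_le_one)
  have half': "inner (z /\<^sub>R sqrt 2) (z /\<^sub>R sqrt 2) \<le> 1 - 1 / 2" if "norm z \<le> 1" for z :: 'a
    using half[OF that] by simp
  have "inner (xp 1 s /\<^sub>R sqrt 2) (y t /\<^sub>R sqrt 2) = 1 / 2 * C $ s $ t"
  proof (rule extreme_split[OF ext, where ?x1.0 = "\<lambda>s. xp 1 s /\<^sub>R sqrt 2" and ?y1.0 = "\<lambda>t. y t /\<^sub>R sqrt 2"
        and ?x2.0 = "\<lambda>s. xp (-1) s /\<^sub>R sqrt 2" and ?y2.0 = "\<lambda>t. y t /\<^sub>R sqrt 2"])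
    show "C $ s' $ t' = inner (xp 1 s' /\<^sub>R sqrt 2) (y t' /\<^sub>R sqrt 2) + inner (xp (- 1) s' /\<^sub>R sqrt 2) (y t' /\<^sub>R sqrt 2)" for s' t'
      by (simp only: sq) (simp add: C xp_def inner_add_left inner_diff_left field_simps)
  qed (intro half half' n, simp add: y)+
  then have "e * inner (y t) (y t) = 0"
    by (simp only: sq) (simp add: xp_def C inner_add_left)
  then have "e = 0" using y[of t] by (auto simp: norm_eq_1)
  then show ?thesis by (simp add: e_def)
qed

section \<open>Realisations of an extreme correlation matrix\<close>

locale extreme_system =
  fixes C :: "real ^ 'n ^ 'm" and x :: "'m::finite \<Rightarrow> 'a::real_inner" and y :: "'n::finite \<Rightarrow> 'a"
  assumes ext: "C extreme_point_of Cor"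
    and x_le: "\<And>s. norm (x s) \<le> 1" and y_le: "\<And>t. norm (y t) \<le> 1"
    and C: "\<And>s t. C $ s $ t = inner (x s) (y t)"
begin

lemma swap: "extreme_system (transpose C) y x"
proof
  show "transpose C extreme_point_of Cor" by (rule extreme_point_transpose[OF ext])
  show "transpose C $ t $ s = inner (y t) (x s)" for s t
    by (simp add: transpose_def C inner_commute[of "x s"])
qed (fact x_le y_le)+

text \<open>The \<open>y t\<close> are first completed to unit vectors by an extra coordinate that the \<open>x s\<close> do not see.\<close>

lemma norm_x: "norm (x s) = 1"
proof -
  have 1: "norm (y t, sqrt (1 - (norm (y t))\<^sup>2)) = 1" for t
    using y_le[of t] by (simp add: norm_prod_def abs_square_le_1)
  have "norm (x s, 0::real) = 1"
    by (rule extreme_norm_if_other_side_unit[OF ext, where x = "\<lambda>s. (x s, 0::real)" and y = "\<lambda>t. (y t, sqrt (1 - (norm (y t))\<^sup>2))"])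
      (use x_le 1 in \<open>auto simp: C\<close>)
  then show ?thesis by simp
qed

text \<open>Removing from each \<open>x s\<close> its component along \<open>z\<close> yields another realisation of \<open>C\<close>. Its
  vectors have norm one as well, so the removed components were zero.\<close>

lemma orthogonal_y_imp_x:
  assumes z: "\<And>t. inner z (y t) = 0"
  shows "inner z (x s) = 0"
proof (cases "z = 0")
  case False
  then have zz: "inner z z > 0" by simp
  define p where "p s = x s - (inner (x s) z / inner z z) *\<^sub>R z" for s
  have pp: "inner (p s) (p s) = inner (x s) (x s) - (inner (x s) z)\<^sup>2 / inner z z" for s
    using zz by (simp add: p_def inner_diff_left inner_diff_right inner_commute power2_eq_square field_simps)
  have le: "norm (p s) \<le> 1" for s
  proof -
    have "inner (p s) (p s) \<le> inner (x s) (x s)" using zz by (simp add: pp)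
    then have "norm (p s) \<le> norm (x s)" by (simp add: norm_eq_sqrt_inner)
    then show ?thesis using x_le order_trans by blast
  qed
  interpret p: extreme_system C p y
    by unfold_locales (use ext le y_le C z in \<open>auto simp: p_def inner_diff_left\<close>)
  have "inner (p s) (p s) = 1" "inner (x s) (x s) = 1"
    using norm_x[of s] p.norm_x[of s] by (auto simp: norm_eq_1)
  then show ?thesis using pp[of s] zz by (auto simp: inner_commute)
qed auto

text \<open>The map \<open>u \<mapsto> (inner u (y t))\<^sub>t\<close> sends \<open>x s\<close> to the row \<open>s\<close> of \<open>C\<close>, and by the previous
  lemma it is injective on the span of the \<open>x s\<close>.\<close>

lemma rank_eq_dim: "rank C = dim (range x)"
proof -
  define f :: "'a \<Rightarrow> real ^ 'n" where "f u = (\<chi> t. inner u (y t))" for u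
  have lin: "linear f" by (rule linearI) (simp_all add: f_def Finite_Cartesian_Product.vec_eq_iff inner_add_left)
  have inj: "inj_on f (span (range x))"
    unfolding linear_injective_on_subspace_0[OF lin subspace_span]
  proof (intro ballI impI)
    fix u assume u: "u \<in> span (range x)" "f u = 0"
    then have "inner u (y t) = 0" for t by (simp add: f_def Finite_Cartesian_Product.vec_eq_iff)
    then have "inner u (x s) = 0" for s by (rule orthogonal_y_imp_x)
    then have "orthogonal u v" if "v \<in> range x" for v
      using that by (auto simp: orthogonal_def)
    then have "orthogonal u u" by (rule orthogonal_to_span[OF u(1)])
    then show "u = 0" by (simp add: orthogonal_def)
  qed
  have "f (x s) = Finite_Cartesian_Product.row s C" for s
    by (simp add: f_def Finite_Cartesian_Product.row_def C Finite_Cartesian_Product.vec_eq_iff)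
  then have img: "f ` range x = Finite_Cartesian_Product.rows C"
    unfolding Finite_Cartesian_Product.rows_def by (simp add: image_image full_SetCompr_eq)
  obtain B where B: "B \<subseteq> range x" "independent B" "range x \<subseteq> span B" "card B = dim (range x)"
    using basis_exists by blast
  have spB: "span B = span (range x)"
    using B by (intro subset_antisym span_mono span_minimal subspace_span)
  have "span (f ` B) = span (Finite_Cartesian_Product.rows C)"
    by (simp add: linear_span_image[OF lin] spB flip: img)
  moreover have "independent (f ` B)"
    using linear_independent_injective_image[OF lin B(2)] inj unfolding spB .
  ultimately have "dim (Finite_Cartesian_Product.rows C) = card (f ` B)"
    by (rule dim_eq_card)
  also have "\<dots> = card B"
    using inj spB by (intro card_image) (metis inj_on_subset span_superset)
  finally show ?thesis by (simp add: row_rank_def B(4))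
qed

text \<open>The component of \<open>y t\<close> orthogonal to all \<open>x s\<close> is orthogonal to \<open>y t\<close> too, by the lemma on
  orthogonality with the two sides exchanged. Hence it vanishes.\<close>

lemma y_in_span_x: "y t \<in> span (range x)"
proof -
  interpret s: extreme_system "transpose C" y x by (rule swap)
  let ?S = "range x"
  obtain u where u: "\<And>i. i < dim ?S \<Longrightarrow> u i \<in> span ?S"
    "\<And>i j. i < dim ?S \<Longrightarrow> j < dim ?S \<Longrightarrow> inner (u i) (u j) = (if i = j then 1 else 0)"
    "\<And>v. v \<in> span ?S \<Longrightarrow> v = (\<Sum>i<dim ?S. inner v (u i) *\<^sub>R u i)"
    by (rule finite_orthonormal_basis[of ?S]) (simp, rule that)
  define q where "q = (\<Sum>i<dim ?S. inner (y t) (u i) *\<^sub>R u i)"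
  define w where "w = y t - q"
  have q: "q \<in> span ?S" unfolding q_def by (intro span_sum span_scale u(1)) auto
  have wu: "inner w (u j) = 0" if "j < dim ?S" for j
  proof -
    have "inner q (u j) = (\<Sum>i<dim ?S. inner (y t) (u i) * inner (u i) (u j))"
      by (simp add: q_def inner_sum_left)
    also have "\<dots> = (\<Sum>i<dim ?S. if i = j then inner (y t) (u i) else 0)"
      using u(2)[OF _ that] by (intro sum.cong) auto
    finally show ?thesis using that by (simp add: w_def inner_diff_left)
  qed
  have wS: "inner w v = 0" if "v \<in> span ?S" for v
    by (subst u(3)[OF that]) (simp add: inner_sum_right wu)
  then have "inner w (x s) = 0" for s by (simp add: span_base)
  then have "inner w (y t) = 0" by (rule s.orthogonal_y_imp_x)
  then have "inner w w = 0" using wS[OF q] by (simp add: w_def inner_diff_right)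
  then show ?thesis using q by (simp add: w_def)
qed

lemma span_eq: "span (range x) = span (range y)"
proof -
  interpret s: extreme_system "transpose C" y x by (rule swap)
  show ?thesis
    by (intro subset_antisym span_minimal subspace_span image_subsetI y_in_span_x s.y_in_span_x)
qed

lemma orthonormal_frame:
  obtains u :: "nat \<Rightarrow> 'a" and a :: "nat \<Rightarrow> 'm \<Rightarrow> real" and b :: "nat \<Rightarrow> 'n \<Rightarrow> real"
  where "\<And>i j. i < rank C \<Longrightarrow> j < rank C \<Longrightarrow> inner (u i) (u j) = (if i = j then 1 else 0)"
    and "\<And>s. x s = (\<Sum>i<rank C. inner (x s) (u i) *\<^sub>R u i)"
    and "\<And>t. y t = (\<Sum>i<rank C. inner (y t) (u i) *\<^sub>R u i)"
    and "\<And>i. i < rank C \<Longrightarrow> u i = (\<Sum>s\<in>UNIV. a i s *\<^sub>R x s)"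
    and "\<And>i. i < rank C \<Longrightarrow> u i = (\<Sum>t\<in>UNIV. b i t *\<^sub>R y t)"
proof -
  have comb: "\<exists>c. v = (\<Sum>k\<in>UNIV. c k *\<^sub>R z k)" if "v \<in> span (range z)" for v :: 'a and z :: "'k::finite \<Rightarrow> 'a"
    using that
  proof (induction rule: span_induct_alt)
    case base
    show ?case by (rule exI[of _ "\<lambda>_. 0"]) simp
  next
    case (step c w v)
    then obtain k d where "w = z k" "v = (\<Sum>k\<in>UNIV. d k *\<^sub>R z k)" by auto
    then have "c *\<^sub>R w + v = (\<Sum>j\<in>UNIV. ((if j = k then c else 0) + d j) *\<^sub>R z j)"
      by (simp add: scaleR_left_distrib sum.distrib if_distrib[of "\<lambda>q. q *\<^sub>R _"] cong: if_cong)
    then show ?case by (intro exI[of _ "\<lambda>j. (if j = k then c else 0) + d j"])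
  qed
  let ?S = "range x"
  obtain u where u: "\<And>i. i < dim ?S \<Longrightarrow> u i \<in> span ?S"
    "\<And>i j. i < dim ?S \<Longrightarrow> j < dim ?S \<Longrightarrow> inner (u i) (u j) = (if i = j then 1 else 0)"
    "\<And>v. v \<in> span ?S \<Longrightarrow> v = (\<Sum>i<dim ?S. inner v (u i) *\<^sub>R u i)"
    by (rule finite_orthonormal_basis[of ?S]) (simp, rule that)
  have "\<forall>i. \<exists>c. i < dim ?S \<longrightarrow> u i = (\<Sum>s\<in>UNIV. c s *\<^sub>R x s)" using comb u(1) by blast
  then obtain a where a: "\<And>i. i < dim ?S \<Longrightarrow> u i = (\<Sum>s\<in>UNIV. a i s *\<^sub>R x s)" by metis
  have "\<forall>i. \<exists>c. i < dim ?S \<longrightarrow> u i = (\<Sum>s\<in>UNIV. c s *\<^sub>R y s)" using comb u(1) span_eq by blast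
  then obtain b where b: "\<And>i. i < dim ?S \<Longrightarrow> u i = (\<Sum>s\<in>UNIV. b i s *\<^sub>R y s)" by metis
  have sx: "x s \<in> span ?S" for s by (simp add: span_base)
  show thesis
    by (rule that[of u a b, unfolded rank_eq_dim, OF u(2) u(3)[OF sx] u(3)[OF y_in_span_x] a b])
qed

end

section \<open>Clifford relations for commuting contractions\<close>

text \<open>Equality in the norm bound: expanding the squared norm of \<open>T (T v) - v\<close> gives a value that is at
  most zero.\<close>

lemma contraction_involutive:
  fixes T :: "'a::real_inner \<Rightarrow> 'a"
  assumes adj: "\<And>v w. inner (T v) w = inner v (T w)" and con: "\<And>v. norm (T v) \<le> norm v"
    and eq: "norm (T v) = norm v"
  shows "T (T v) = v"
proof -
  have vv: "inner (T v) (T v) = inner v v"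
    using eq by (simp add: norm_eq_sqrt_inner)
  have le: "inner (T (T v)) (T (T v)) \<le> inner v v"
    using con[of "T v"] unfolding eq by (simp add: norm_eq_sqrt_inner)
  have "inner (T (T v)) v = inner v v" using adj[of "T v" v] vv by simp
  then have "inner (T (T v) - v) (T (T v) - v) \<le> 0"
    using le by (simp add: inner_diff_left inner_diff_right inner_commute[of v "T (T v)"])
  then show ?thesis
    by (metis inner_ge_zero inner_eq_zero_iff order_antisym right_minus_eq)
qed

text \<open>An abstract form of a tensor operator representation: \<open>L s\<close> stands for \<open>X s \<otimes> 1\<close> and \<open>R t\<close>
  for \<open>1 \<otimes> Y t\<close>. Only commutation of the two families is retained from the tensor product.\<close>

locale tensor_system =
  fixes C :: "real ^ 'n ^ 'm" and L :: "'m::finite \<Rightarrow> 'a::real_inner \<Rightarrow> 'a"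
    and R :: "'n::finite \<Rightarrow> 'a \<Rightarrow> 'a" and \<psi> :: 'a
  assumes ext: "C extreme_point_of Cor"
    and linL: "\<And>s. linear (L s)" and linR: "\<And>t. linear (R t)"
    and adjL: "\<And>s v w. inner (L s v) w = inner v (L s w)"
    and adjR: "\<And>t v w. inner (R t v) w = inner v (R t w)"
    and conL: "\<And>s v. norm (L s v) \<le> norm v" and conR: "\<And>t v. norm (R t v) \<le> norm v"
    and comm: "\<And>s t v. L s (R t v) = R t (L s v)"
    and unit: "norm \<psi> = 1"
    and C: "\<And>s t. C $ s $ t = inner (L s \<psi>) (R t \<psi>)"
begin

sublocale extreme_system C "\<lambda>s. L s \<psi>" "\<lambda>t. R t \<psi>"
  by unfold_locales (use ext C conL[of _ \<psi>] conR[of _ \<psi>] unit in auto)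

lemma LL: "L s (L s \<psi>) = \<psi>"
  by (rule contraction_involutive[OF adjL conL]) (simp add: norm_x unit)

lemma RR: "R t (R t \<psi>) = \<psi>"
proof -
  interpret s: extreme_system "transpose C" "\<lambda>t. R t \<psi>" "\<lambda>s. L s \<psi>" by (rule swap)
  show ?thesis by (rule contraction_involutive[OF adjR conR]) (simp add: s.norm_x unit)
qed

text \<open>This is where extremality determines anticommutators. Fix \<open>t\<close>, \<open>t'\<close> and put
  \<open>D \<sigma> = R t + \<sigma> R t'\<close>. For \<open>\<sigma> = 1\<close> and \<open>\<sigma> = -1\<close> the vectors \<open>D \<sigma> (L s \<psi>)\<close> and
  \<open>D \<sigma> (W k \<psi>)\<close>, halved, have squared norm \<open>(1 + \<sigma> g) / 2\<close> with \<open>g = inner (R t \<psi>) (R t' \<psi>)\<close>,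
  and their Gram blocks add up to \<open>C\<close>. By \<open>extreme_split\<close> the block for \<open>\<sigma> = 1\<close> is
  \<open>(1 + g) / 2\<close> times \<open>C\<close>, which is the claim for \<open>v = L s \<psi>\<close> and \<open>w = R k \<psi>\<close>; both sides are
  bilinear in \<open>v\<close> and \<open>w\<close>.\<close>

lemma polarized_R:
  assumes v: "v \<in> span (range (\<lambda>s. L s \<psi>))" and w: "w \<in> span (range (\<lambda>t. R t \<psi>))"
  shows "inner (R t v) (R t' w) + inner (R t' v) (R t w) = 2 * inner (R t \<psi>) (R t' \<psi>) * inner v w"
proof -
  obtain u :: "nat \<Rightarrow> 'a" and a b
    where y: "\<And>t. R t \<psi> = (\<Sum>i<rank C. inner (R t \<psi>) (u i) *\<^sub>R u i)"
    and u: "\<And>i. i < rank C \<Longrightarrow> u i = (\<Sum>s\<in>UNIV. a i s *\<^sub>R L s \<psi>)"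
    by (rule orthonormal_frame) (rule that)
  \<comment> \<open>W t is a combination of the L s that agrees with R t on the state and, unlike R t, commutes with every R k.\<close>
  define W where "W t v = (\<Sum>i<rank C. inner (R t \<psi>) (u i) *\<^sub>R (\<Sum>s\<in>UNIV. a i s *\<^sub>R L s v))" for t v
  have W: "W t \<psi> = R t \<psi>" for t
    by (subst y) (auto simp: W_def u intro!: sum.cong)
  have adjW: "inner (W t v) w = inner v (W t w)" for t v w
    by (simp add: W_def inner_sum_left inner_sum_right adjL)
  have commW: "W k (R t v) = R t (W k v)" for k t v
    by (simp add: W_def comm linear_sum[OF linR] linear_cmul[OF linR])
  have WW: "W t (W t \<psi>) = \<psi>" for t by (simp add: W commW RR)
  have base: "inner (R t (L s \<psi>)) (R t' (R k \<psi>)) + inner (R t' (L s \<psi>)) (R t (R k \<psi>))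
      = 2 * inner (R t \<psi>) (R t' \<psi>) * inner (L s \<psi>) (R k \<psi>)" for s t t' k
  proof -
    define g where "g = inner (R t \<psi>) (R t' \<psi>)"
    define D where "D \<sigma> v = R t v + \<sigma> *\<^sub>R R t' v" for \<sigma> v
    have adjD: "inner (D \<sigma> v) w = inner v (D \<sigma> w)" for \<sigma> v w
      by (simp add: D_def inner_add_left inner_add_right adjR)
    have R1: "inner (R k \<psi>) (R k \<psi>) = 1" for k
      using unit by (simp add: adjR RR norm_eq_1)
    have nD: "inner (D \<sigma> (P \<psi>)) (D \<sigma> (P \<psi>)) = 1 + \<sigma>\<^sup>2 + 2 * \<sigma> * g"
      if adjP: "\<And>v w. inner (P v) w = inner v (P w)" and linP: "linear P"
        and commP: "\<And>t v. P (R t v) = R t (P v)" and PP: "P (P \<psi>) = \<psi>" for \<sigma> and P :: "'a \<Rightarrow> 'a"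
    proof -
      have PD: "P (D \<sigma> v) = D \<sigma> (P v)" for v
        by (simp add: D_def linear_add[OF linP] linear_cmul[OF linP] commP)
      have "inner (D \<sigma> (P \<psi>)) (D \<sigma> (P \<psi>)) = inner (P (D \<sigma> \<psi>)) (P (D \<sigma> \<psi>))" by (simp add: PD)
      also have "\<dots> = inner (D \<sigma> \<psi>) (D \<sigma> (P (P \<psi>)))" by (simp only: adjP) (simp only: PD)
      also have "\<dots> = inner (D \<sigma> \<psi>) (D \<sigma> \<psi>)" by (simp add: PP)
      also have "\<dots> = inner (R t \<psi>) (R t \<psi>) + \<sigma>\<^sup>2 * inner (R t' \<psi>) (R t' \<psi>) + 2 * \<sigma> * g"
        by (simp add: D_def inner_add_left inner_add_right g_def inner_commute[of "R t' \<psi>" "R t \<psi>"] power2_eq_square algebra_simps)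
      finally show ?thesis by (simp add: R1)
    qed
    have linW: "linear (W k)" for k
      unfolding W_def by (intro linear_compose_sum ballI linear_compose_scale_right linL)
    have nL: "inner (D \<sigma> (L s \<psi>)) (D \<sigma> (L s \<psi>)) = 1 + \<sigma>\<^sup>2 + 2 * \<sigma> * g" for \<sigma> s
      by (rule nD[OF adjL linL comm LL])
    have nW: "inner (D \<sigma> (W k \<psi>)) (D \<sigma> (W k \<psi>)) = 1 + \<sigma>\<^sup>2 + 2 * \<sigma> * g" for \<sigma> k
      by (rule nD[OF adjW linW commW WW])
    have RRW: "R t (R t (W k \<psi>)) = W k \<psi>" for t k by (simp flip: commW add: RR)
    have ip: "inner (D \<sigma> (L s \<psi>)) (D \<sigma> (W k \<psi>)) = (1 + \<sigma>\<^sup>2) * inner (L s \<psi>) (W k \<psi>)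
        + \<sigma> * (inner (R t (L s \<psi>)) (R t' (W k \<psi>)) + inner (R t' (L s \<psi>)) (R t (W k \<psi>)))" for \<sigma> s k
    proof -
      have "inner (R t (L s \<psi>)) (R t (W k \<psi>)) = inner (L s \<psi>) (W k \<psi>)" for t
        by (simp only: adjR[of t "L s \<psi>"] RRW)
      then show ?thesis
        by (simp add: D_def inner_add_left inner_add_right power2_eq_square algebra_simps)
    qed
    have "inner (D 1 (L s \<psi>) /\<^sub>R 2) (D 1 (W k \<psi>) /\<^sub>R 2) = (1 + g) / 2 * C $ s $ k"
    proof (rule extreme_split[OF ext, where ?x1.0 = "\<lambda>s. D 1 (L s \<psi>) /\<^sub>R 2" and ?y1.0 = "\<lambda>k. D 1 (W k \<psi>) /\<^sub>R 2"
          and ?x2.0 = "\<lambda>s. D (-1) (L s \<psi>) /\<^sub>R 2" and ?y2.0 = "\<lambda>k. D (-1) (W k \<psi>) /\<^sub>R 2"])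
      show "C $ s $ k = inner (D 1 (L s \<psi>) /\<^sub>R 2) (D 1 (W k \<psi>) /\<^sub>R 2)
          + inner (D (-1) (L s \<psi>) /\<^sub>R 2) (D (-1) (W k \<psi>) /\<^sub>R 2)" for s k
        by (simp add: ip) (simp add: C W field_simps)
    qed (simp_all add: nL nW field_simps)
    then have "(2 * inner (L s \<psi>) (W k \<psi>) + (inner (R t (L s \<psi>)) (R t' (W k \<psi>)) + inner (R t' (L s \<psi>)) (R t (W k \<psi>)))) / 4
        = (1 + g) / 2 * C $ s $ k"
      by (simp add: ip)
    then show ?thesis unfolding W by (simp add: C g_def field_simps)
  qed
  let ?P = "\<lambda>v w. \<forall>t t'. inner (R t v) (R t' w) + inner (R t' v) (R t w) = 2 * inner (R t \<psi>) (R t' \<psi>) * inner v w"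
  have "?P v (R k \<psi>)" for k
    using v
  proof (induction rule: span_induct_alt)
    case (step c x y)
    then obtain s where "x = L s \<psi>" by auto
    then show ?case using step base
      by (simp add: linear_add[OF linR] linear_cmul[OF linR] inner_add_left algebra_simps)
        (simp flip: distrib_left)
  qed (simp add: linear_0[OF linR])
  with w have "?P v w"
  proof (induction rule: span_induct_alt)
    case (step c x y)
    then obtain s where "x = R s \<psi>" by auto
    then show ?case using step
      by (simp add: linear_add[OF linR] linear_cmul[OF linR] inner_add_right algebra_simps)
        (simp flip: distrib_left)
  qed (simp add: linear_0[OF linR])
  then show ?thesis by blast
qed

text \<open>On the state, a product of \<open>A i = \<Sum>s. a i s L s\<close> and \<open>A j\<close> equals the reversed product of the
  corresponding combinations \<open>B i\<close>, \<open>B j\<close> of the \<open>R t\<close>. The previous lemma gives the inner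
  products needed to see that \<open>B i (u i) - \<psi>\<close> and, for \<open>i \<noteq> j\<close>, \<open>B i (u j) + B j (u i)\<close> have
  norm zero.\<close>

lemma clifford_relations:
  obtains a :: "nat \<Rightarrow> 'm \<Rightarrow> real" and b :: "nat \<Rightarrow> 'n \<Rightarrow> real"
  where "\<And>i. i < rank C \<Longrightarrow> (\<Sum>s\<in>UNIV. a i s *\<^sub>R L s \<psi>) = (\<Sum>t\<in>UNIV. b i t *\<^sub>R R t \<psi>)"
    and "\<And>i. i < rank C \<Longrightarrow> (\<Sum>s\<in>UNIV. a i s *\<^sub>R L s (\<Sum>s\<in>UNIV. a i s *\<^sub>R L s \<psi>)) = \<psi>"
    and "\<And>i j. i < rank C \<Longrightarrow> j < rank C \<Longrightarrow> i \<noteq> j \<Longrightarrow>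
      (\<Sum>s\<in>UNIV. a i s *\<^sub>R L s (\<Sum>s\<in>UNIV. a j s *\<^sub>R L s \<psi>)) =
      - (\<Sum>s\<in>UNIV. a j s *\<^sub>R L s (\<Sum>s\<in>UNIV. a i s *\<^sub>R L s \<psi>))"
proof -
  let ?r = "rank C"
  obtain u :: "nat \<Rightarrow> 'a" and a b
    where on: "\<And>i j. i < ?r \<Longrightarrow> j < ?r \<Longrightarrow> inner (u i) (u j) = (if i = j then 1 else 0)"
    and ua: "\<And>i. i < ?r \<Longrightarrow> u i = (\<Sum>s\<in>UNIV. a i s *\<^sub>R L s \<psi>)"
    and ub: "\<And>i. i < ?r \<Longrightarrow> u i = (\<Sum>t\<in>UNIV. b i t *\<^sub>R R t \<psi>)"
    by (rule orthonormal_frame) (rule that)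
  define B where "B i v = (\<Sum>t\<in>UNIV. b i t *\<^sub>R R t v)" for i v
  have adjB: "inner (B i v) w = inner v (B i w)" for i v w
    by (simp add: B_def inner_sum_left inner_sum_right adjR)
  have uB: "u i = B i \<psi>" if "i < ?r" for i using ub[OF that] by (simp add: B_def)
  have AB: "(\<Sum>s\<in>UNIV. a i s *\<^sub>R L s (u j)) = B j (u i)" if "i < ?r" "j < ?r" for i j
  proof -
    have "(\<Sum>s\<in>UNIV. a i s *\<^sub>R L s (u j)) = (\<Sum>s\<in>UNIV. \<Sum>t\<in>UNIV. a i s *\<^sub>R b j t *\<^sub>R R t (L s \<psi>))"
      by (simp add: ub[OF that(2)] linear_sum[OF linL] linear_cmul[OF linL] comm scaleR_right.sum)
    also have "\<dots> = (\<Sum>t\<in>UNIV. \<Sum>s\<in>UNIV. a i s *\<^sub>R b j t *\<^sub>R R t (L s \<psi>))" by (rule sum.swap)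
    also have "\<dots> = B j (u i)"
      by (simp add: ua[OF that(1)] B_def linear_sum[OF linR] linear_cmul[OF linR] scaleR_right.sum mult.commute)
    finally show ?thesis .
  qed
  have ux: "u i \<in> span (range (\<lambda>s. L s \<psi>))" if "i < ?r" for i
    unfolding ua[OF that] by (intro span_sum span_scale span_base) auto
  have uy: "u i \<in> span (range (\<lambda>t. R t \<psi>))" if "i < ?r" for i
    using ux[OF that] span_eq by simp
  have pol: "inner (B k (u i)) (B l (u j)) + inner (B l (u i)) (B k (u j)) = 2 * inner (u k) (u l) * inner (u i) (u j)"
    if "i < ?r" "j < ?r" "k < ?r" "l < ?r" for i j k l
  proof -
    have e: "inner (B k v) (B l w) = (\<Sum>t\<in>UNIV. \<Sum>t'\<in>UNIV. b k t * b l t' * inner (R t v) (R t' w))" for k l v w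
      by (simp only: B_def inner_sum_left inner_scaleR_left)
        (simp only: inner_sum_right inner_scaleR_right sum_distrib_left mult.assoc)
    have "inner (B k (u i)) (B l (u j)) + inner (B l (u i)) (B k (u j))
      = (\<Sum>t\<in>UNIV. \<Sum>t'\<in>UNIV. b k t * b l t' * (inner (R t (u i)) (R t' (u j)) + inner (R t' (u i)) (R t (u j))))"
      unfolding e[of k] e[of l] by (subst (2) sum.swap) (simp add: sum.distrib algebra_simps)
    also have "\<dots> = (\<Sum>t\<in>UNIV. \<Sum>t'\<in>UNIV. b k t * b l t' * (2 * inner (R t \<psi>) (R t' \<psi>) * inner (u i) (u j)))"
      using polarized_R[OF ux uy] that by simp
    also have "\<dots> = 2 * inner (B k \<psi>) (B l \<psi>) * inner (u i) (u j)"
      unfolding e by (simp add: sum_distrib_left sum_distrib_right algebra_simps)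
    finally show ?thesis using uB that by simp
  qed
  have sq: "B i (u i) = \<psi>" if "i < ?r" for i
  proof -
    have "inner (B i (u i)) (B i (u i)) = 1" using pol[OF that that that that] on that by simp
    moreover have "inner (B i (u i)) \<psi> = 1" using adjB[of i "u i" \<psi>] uB[OF that] on[OF that that] by simp
    ultimately have "inner (B i (u i) - \<psi>) (B i (u i) - \<psi>) = 0"
      using unit by (simp add: inner_diff_left inner_diff_right inner_commute[of \<psi> "B i (u i)"] norm_eq_1)
    then show ?thesis by simp
  qed
  have anti: "B i (u j) + B j (u i) = 0" if ij: "i < ?r" "j < ?r" "i \<noteq> j" for i j
  proof -
    have "inner (B j (u i)) (B j (u i)) = 1" "inner (B i (u j)) (B i (u j)) = 1"
      using pol[of i i j j] pol[of j j i i] on ij by auto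
    moreover have "inner (B j (u i)) (B i (u j)) = - 1"
      using pol[of i j j i] on ij sq unit by (simp add: norm_eq_1)
    ultimately have "inner (B i (u j) + B j (u i)) (B i (u j) + B j (u i)) = 0"
      by (simp add: inner_add_left inner_add_right inner_commute[of "B i (u j)" "B j (u i)"])
    then show ?thesis by simp
  qed
  show thesis
  proof (rule that[of a b])
    fix i j assume i: "i < ?r"
    show "(\<Sum>s\<in>UNIV. a i s *\<^sub>R L s \<psi>) = (\<Sum>t\<in>UNIV. b i t *\<^sub>R R t \<psi>)"
      using ua[OF i] ub[OF i] by simp
    show "(\<Sum>s\<in>UNIV. a i s *\<^sub>R L s (\<Sum>s\<in>UNIV. a i s *\<^sub>R L s \<psi>)) = \<psi>"
      using AB[OF i i] sq[OF i] ua[OF i] by simp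
    assume j: "j < ?r" "i \<noteq> j"
    show "(\<Sum>s\<in>UNIV. a i s *\<^sub>R L s (\<Sum>s\<in>UNIV. a j s *\<^sub>R L s \<psi>)) =
      - (\<Sum>s\<in>UNIV. a j s *\<^sub>R L s (\<Sum>s\<in>UNIV. a i s *\<^sub>R L s \<psi>))"
      using AB[OF i j(1)] AB[OF j(1) i] anti[OF i j] ua[OF i] ua[OF j(1)]
      by (simp add: eq_neg_iff_add_eq_0 add.commute)
  qed
qed

end

section \<open>Orthogonal families from anticommuting involutions\<close>

text \<open>\<open>J\<close> is the complex structure of \<open>V\<close>, so the bound says that the complex dimension is at least
  \<open>2 ^ (r div 2)\<close>. The induction removes two generators \<open>a\<close>, \<open>b\<close> at a time: \<open>P = J a b\<close> is a
  self-adjoint involution that commutes with \<open>J\<close> and with the other generators and anticommutes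
  with \<open>a\<close>. The induction hypothesis applies to its fixed space, and \<open>a\<close> carries the family found
  there isometrically into the eigenspace for \<open>-1\<close>, which is orthogonal to it.\<close>

lemma clifford_orthogonal_family:
  fixes A :: "nat \<Rightarrow> 'a::real_inner \<Rightarrow> 'a" and J :: "'a \<Rightarrow> 'a"
  assumes linJ: "linear J" and JJ: "\<And>v. J (J v) = - v"
    and skew: "\<And>v w. inner (J v) w = - inner v (J w)"
    and linA: "\<And>i. linear (A i)" and adjA: "\<And>i v w. inner (A i v) w = inner v (A i w)"
    and AJ: "\<And>i v. A i (J v) = J (A i v)"
    and V: "subspace V" "V \<noteq> {0}" "\<And>v. v \<in> V \<Longrightarrow> J v \<in> V"
    and VA: "\<And>i v. i < r \<Longrightarrow> v \<in> V \<Longrightarrow> A i v \<in> V"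
    and sq: "\<And>i v. i < r \<Longrightarrow> v \<in> V \<Longrightarrow> A i (A i v) = v"
    and anti: "\<And>i j v. i < r \<Longrightarrow> j < r \<Longrightarrow> i \<noteq> j \<Longrightarrow> v \<in> V \<Longrightarrow> A i (A j v) = - A j (A i v)"
  shows "\<exists>S \<subseteq> V. finite S \<and> card S = 2 * 2 ^ (r div 2) \<and> pairwise orthogonal S \<and> 0 \<notin> S"
proof -
  have nJ: "J (- v) = - J v" for v by (rule linear_neg[OF linJ])
  have nA: "A i (- v) = - A i v" for i v by (rule linear_neg[OF linA])
  have zJ: "J 0 = 0" by (rule linear_0[OF linJ])
  have zA: "A i 0 = 0" for i by (rule linear_0[OF linA])
  \<comment> \<open>The hypotheses that depend on r and V, bundled for an induction over r with V arbitrary.\<close>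
  define Q where "Q r V \<longleftrightarrow> subspace V \<and> V \<noteq> {0} \<and> (\<forall>v\<in>V. J v \<in> V) \<and>
    (\<forall>i<r. \<forall>v\<in>V. A i v \<in> V \<and> A i (A i v) = v \<and> (\<forall>j<r. i \<noteq> j \<longrightarrow> A i (A j v) = - A j (A i v)))"
    for r :: nat and V
  have base: "\<exists>S \<subseteq> V. finite S \<and> card S = 2 \<and> pairwise orthogonal S \<and> 0 \<notin> S" if Q: "Q r V" for r V
  proof -
    have "subspace V" "V \<noteq> {0}" using Q by (auto simp: Q_def)
    then obtain v where v: "v \<in> V" "v \<noteq> 0" using subspace_0 by blast
    have o: "inner v (J v) = 0" using skew[of v v] by (simp add: inner_commute[of "J v" v])
    have J0: "J v \<noteq> 0" using JJ[of v] v(2) zJ by auto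
    have ne: "v \<noteq> J v" using o v(2) by (metis inner_eq_zero_iff)
    have "J v \<in> V" using Q v by (simp add: Q_def)
    then have "{v, J v} \<subseteq> V \<and> finite {v, J v} \<and> card {v, J v} = 2 \<and> pairwise orthogonal {v, J v} \<and> 0 \<notin> {v, J v}"
      using v J0 ne o by (auto simp: pairwise_insert orthogonal_def inner_commute[of "J v" v])
    then show ?thesis by blast
  qed
  have "Q r V \<Longrightarrow> \<exists>S \<subseteq> V. finite S \<and> card S = 2 * 2 ^ (r div 2) \<and> pairwise orthogonal S \<and> 0 \<notin> S"
  proof (induction r arbitrary: V rule: induct_nat_012)
    case 0
    then show ?case using base[of 0 V] by simp
  next
    case 1
    then show ?case using base[of "Suc 0" V] by simp
  next
    case (ge2 r)
    define a b where "a = A r" and "b = A (Suc r)"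
    define P where "P v = J (a (b v))" for v
    define V' where "V' = {v \<in> V. P v = v}"
    have sub: "subspace V" and nz: "V \<noteq> {0}" and JV: "\<And>v. v \<in> V \<Longrightarrow> J v \<in> V"
      using ge2.prems by (auto simp: Q_def)
    have AV: "A i v \<in> V" and sqV: "A i (A i v) = v" if "i < Suc (Suc r)" "v \<in> V" for i v
      using ge2.prems that by (auto simp: Q_def)
    have antiV: "A i (A j v) = - A j (A i v)" if "i < Suc (Suc r)" "j < Suc (Suc r)" "i \<noteq> j" "v \<in> V" for i j v
      using ge2.prems that unfolding Q_def by blast
    have aV: "a v \<in> V" and bV: "b v \<in> V" and aa: "a (a v) = v" and bb: "b (b v) = v"
      and ba: "b (a v) = - a (b v)" if "v \<in> V" for v
      using that AV sqV antiV[of "Suc r" r v] by (auto simp: a_def b_def)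
    have na: "a (- v) = - a v" and nb: "b (- v) = - b v" for v by (simp_all add: a_def b_def nA)
    have aJ: "a (J v) = J (a v)" and bJ: "b (J v) = J (b v)" for v by (simp_all add: a_def b_def AJ)
    have linP: "linear P"
      unfolding P_def a_def b_def
      using linear_compose[OF linear_compose[OF linA[of "Suc r"] linA[of r]] linJ] by (simp add: o_def)
    have PV: "P v \<in> V" if "v \<in> V" for v using that by (simp add: P_def JV aV bV)
    have PP: "P (P v) = v" if "v \<in> V" for v
      using that by (simp add: P_def aJ bJ JJ ba aa bb aV bV na nJ)
    have Pa: "P (a v) = - a (P v)" if "v \<in> V" for v
      using that by (simp add: P_def aJ ba na nJ aa bV)
    have adjP: "inner (P v) w = inner v (P w)" if "w \<in> V" for v w
    proof -
      have "inner (P v) w = - inner v (b (a (J w)))"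
        by (simp add: P_def skew) (simp add: a_def b_def adjA)
      also have "b (a (J w)) = - P w" using that by (simp add: P_def aJ bJ ba nJ)
      finally show ?thesis by simp
    qed
    have V'V: "V' \<subseteq> V" by (auto simp: V'_def)
    have "subspace V'"
      unfolding V'_def subspace_def
      using sub by (auto simp: linear_0[OF linP] linear_add[OF linP] linear_cmul[OF linP] subspace_0 subspace_add subspace_scale)
    moreover have "V' \<noteq> {0}"
    proof -
      obtain v where v: "v \<in> V" "v \<noteq> 0" using nz sub subspace_0 by blast
      show ?thesis
      proof (cases "v + P v = 0")
        case False
        have "v + P v \<in> V'" using v PV PP sub
          by (simp add: V'_def subspace_add linear_add[OF linP] add.commute)
        then show ?thesis using False by blast
      next
        case True
        then have "P v = - v" by (simp add: eq_neg_iff_add_eq_0 add.commute)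
        then have "a v \<in> V'" using v Pa[of v] aV by (simp add: V'_def na)
        moreover have "a v \<noteq> 0" using aa[of v] v zA by (auto simp: a_def)
        ultimately show ?thesis by blast
      qed
    qed
    moreover have "J v \<in> V'" if "v \<in> V'" for v
    proof -
      have "P (J v) = J (P v)" by (simp add: P_def aJ bJ)
      then show ?thesis using that JV by (auto simp: V'_def)
    qed
    moreover have "A i v \<in> V'" if "i < r" "v \<in> V'" for i v
    proof -
      have v: "v \<in> V" using that V'V by auto
      have "a (b (A i v)) = A i (a (b v))"
        using antiV[of i r "b v"] antiV[of i "Suc r" v] that v AV[of "Suc r" v]
        by (simp add: a_def b_def nA)
      then have "P (A i v) = A i (P v)" by (simp add: P_def AJ)
      then show ?thesis using that v AV[of i v] by (simp add: V'_def)
    qed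
    ultimately have "Q r V'"
      unfolding Q_def using V'V sqV antiV
      by (metis less_SucI subset_iff)
    from ge2.IH(1)[OF this] obtain S where S: "S \<subseteq> V'" "finite S" "card S = 2 * 2 ^ (r div 2)"
      "pairwise orthogonal S" "0 \<notin> S" by blast
    have SV: "s \<in> V" "P s = s" if "s \<in> S" for s using S(1) that by (auto simp: V'_def)
    have ip: "inner (a s) (a t) = inner s t" if "s \<in> S" "t \<in> S" for s t
      using aa[OF SV(1)[OF that(2)]] by (simp add: a_def adjA)
    have cross: "inner s (a t) = 0" if "s \<in> S" "t \<in> S" for s t
    proof -
      have "inner s (a t) = inner (P s) (a t)" using SV that by simp
      also have "\<dots> = inner s (P (a t))" using adjP[of "a t" s] SV that aV by simp
      also have "\<dots> = - inner s (a t)" using Pa[of t] SV that by simp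
      finally show ?thesis by simp
    qed
    have inj: "inj_on a S" by (rule inj_on_inverseI[of _ a]) (use aa SV in auto)
    have disj: "S \<inter> a ` S = {}" using cross S(5) by (auto simp: disjoint_iff) (metis inner_eq_zero_iff)
    have "S \<union> a ` S \<subseteq> V" using SV aV by auto
    moreover have "card (S \<union> a ` S) = 2 * 2 ^ (Suc (Suc r) div 2)"
      using card_Un_disjoint[OF S(2) _ disj] S(2,3) card_image[OF inj] by simp
    moreover have "pairwise orthogonal (S \<union> a ` S)"
    proof (rule pairwiseI)
      fix x y assume xy: "x \<in> S \<union> a ` S" "y \<in> S \<union> a ` S" "x \<noteq> y"
      have o: "inner s t = 0" if "s \<in> S" "t \<in> S" "s \<noteq> t" for s t
        using S(4) that by (auto simp: pairwise_def orthogonal_def)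
      have o': "inner (a s) (a t) = 0" if "s \<in> S" "t \<in> S" "a s \<noteq> a t" for s t
        using ip o that by metis
      have cross': "inner (a t) s = 0" if "s \<in> S" "t \<in> S" for s t
        using cross[OF that] by (simp add: inner_commute)
      from xy show "orthogonal x y"
        unfolding orthogonal_def by (elim UnE imageE) (simp_all add: o o' cross cross')
    qed
    moreover have "0 \<notin> S \<union> a ` S"
      using S(5) ip by (metis UnE imageE inner_eq_zero_iff inner_zero_left)
    ultimately show ?case using S(2) by (intro exI[of _ "S \<union> a ` S"]) auto
  qed
  moreover have "Q r V" unfolding Q_def using V VA sq anti by blast
  ultimately show ?thesis by blast
qed

section \<open>Finitely supported complex functions as a real inner product space\<close>

text \<open>One space that contains the coordinate spaces of all dimensions, so that the results on real inner
  product spaces apply to systems whose dimension is a variable.\<close>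

typedef 'i fsupp = "{f :: 'i \<Rightarrow> complex. finite {i. f i \<noteq> 0}}"
  morphisms coord Abs_fsupp
  by (rule exI[of _ "\<lambda>_. 0"]) simp

setup_lifting type_definition_fsupp

lemma fsupp_eqI: "(\<And>i. coord f i = coord g i) \<Longrightarrow> f = g"
  by (simp add: coord_inject[symmetric] fun_eq_iff)

lemma finite_coord: "finite {i. coord f i \<noteq> 0}"
  using coord[of f] by simp

instantiation fsupp :: (type) real_vector
begin

lift_definition zero_fsupp :: "'a fsupp" is "\<lambda>_. 0" by simp
lift_definition plus_fsupp :: "'a fsupp \<Rightarrow> 'a fsupp \<Rightarrow> 'a fsupp" is "\<lambda>f g i. f i + g i"
  by (erule (1) finite_subset[rotated, OF finite_UnI]) auto
lift_definition uminus_fsupp :: "'a fsupp \<Rightarrow> 'a fsupp" is "\<lambda>f i. - f i" by simp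
lift_definition minus_fsupp :: "'a fsupp \<Rightarrow> 'a fsupp \<Rightarrow> 'a fsupp" is "\<lambda>f g i. f i - g i"
  by (erule (1) finite_subset[rotated, OF finite_UnI]) auto
lift_definition scaleR_fsupp :: "real \<Rightarrow> 'a fsupp \<Rightarrow> 'a fsupp" is "\<lambda>c f i. c *\<^sub>R f i"
  by (erule finite_subset[rotated]) auto

instance
  by standard (transfer; simp add: fun_eq_iff algebra_simps)+

end

lemmas coord_simps [simp] = zero_fsupp.rep_eq plus_fsupp.rep_eq uminus_fsupp.rep_eq minus_fsupp.rep_eq scaleR_fsupp.rep_eq

instantiation fsupp :: (type) real_inner
begin

definition inner_fsupp :: "'a fsupp \<Rightarrow> 'a fsupp \<Rightarrow> real" where
  "inner_fsupp f g = (\<Sum>i | coord f i \<noteq> 0. Re (coord f i * cnj (coord g i)))"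
definition norm_fsupp :: "'a fsupp \<Rightarrow> real" where "norm_fsupp f = sqrt (inner f f)"
definition dist_fsupp :: "'a fsupp \<Rightarrow> 'a fsupp \<Rightarrow> real" where "dist_fsupp f g = norm (f - g)"
definition sgn_fsupp :: "'a fsupp \<Rightarrow> 'a fsupp" where "sgn_fsupp f = f /\<^sub>R norm f"
definition uniformity_fsupp :: "('a fsupp \<times> 'a fsupp) filter" where
  "uniformity_fsupp = (INF e\<in>{0<..}. principal {(x, y). dist x y < e})"
definition open_fsupp :: "'a fsupp set \<Rightarrow> bool" where
  "open_fsupp U = (\<forall>x\<in>U. eventually (\<lambda>(x', y). x' = x \<longrightarrow> y \<in> U) uniformity)"

lemma inner_fsupp_eq:
  fixes f g :: "'a fsupp"
  assumes "finite I" "\<And>i. coord f i \<noteq> 0 \<Longrightarrow> coord g i \<noteq> 0 \<Longrightarrow> i \<in> I"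
  shows "inner f g = (\<Sum>i\<in>I. Re (coord f i * cnj (coord g i)))"
  unfolding inner_fsupp_def
proof (rule sum.mono_neutral_cong)
  fix i assume i: "i \<in> {i. coord f i \<noteq> 0} - I"
  then have "coord g i = 0" using assms(2) by blast
  then show "Re (coord f i * cnj (coord g i)) = 0" by simp
qed (use assms(1) finite_coord[of f] in simp_all)

instance
proof
  fix f g h :: "'a fsupp" and c :: real
  let ?I = "{i. coord f i \<noteq> 0} \<union> {i. coord g i \<noteq> 0} \<union> {i. coord h i \<noteq> 0}"
  have fin: "finite ?I" using finite_coord[of f] finite_coord[of g] finite_coord[of h] by simp
  have eq: "inner f' g' = (\<Sum>i\<in>?I. Re (coord f' i * cnj (coord g' i)))"
    if "\<And>i. coord f' i \<noteq> 0 \<Longrightarrow> i \<in> ?I" for f' g'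
    by (rule inner_fsupp_eq[OF fin]) (use that in auto)
  have f: "inner f w = (\<Sum>i\<in>?I. Re (coord f i * cnj (coord w i)))" for w by (rule eq) auto
  have g: "inner g w = (\<Sum>i\<in>?I. Re (coord g i * cnj (coord w i)))" for w by (rule eq) auto
  have fg: "inner (f + g) h = (\<Sum>i\<in>?I. Re (coord (f + g) i * cnj (coord h i)))" by (rule eq) auto
  have cf: "inner (c *\<^sub>R f) g = (\<Sum>i\<in>?I. Re (coord (c *\<^sub>R f) i * cnj (coord g i)))" by (rule eq) auto
  have ff: "inner f f = (\<Sum>i\<in>?I. (cmod (coord f i))\<^sup>2)"
    unfolding f by (simp add: complex_mult_cnj cmod_power2 flip: power2_eq_square)
  show "inner f g = inner g f"
    unfolding f g by (intro sum.cong) auto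
  show "inner (f + g) h = inner f h + inner g h"
    unfolding f g fg sum.distrib[symmetric] by (intro sum.cong) (auto simp: algebra_simps)
  show "inner (c *\<^sub>R f) g = c * inner f g"
    unfolding f cf sum_distrib_left by (intro sum.cong) (auto simp: algebra_simps)
  show "0 \<le> inner f f" unfolding ff by (intro sum_nonneg) auto
  show "inner f f = 0 \<longleftrightarrow> f = 0"
  proof
    assume "inner f f = 0"
    then have z: "(\<Sum>i\<in>?I. (cmod (coord f i))\<^sup>2) = 0" unfolding ff .
    show "f = 0"
    proof (rule fsupp_eqI)
      fix i
      have "(cmod (coord f i))\<^sup>2 = 0" if "i \<in> ?I"
        by (rule sum_nonneg_0[OF fin _ z that]) simp
      then show "coord f i = coord 0 i" by (cases "i \<in> ?I") simp_all
    qed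
  qed (simp add: inner_fsupp_def)
  show "norm f = sqrt (inner f f)" by (rule norm_fsupp_def)
qed (rule dist_fsupp_def sgn_fsupp_def uniformity_fsupp_def open_fsupp_def)+

end

lift_definition imult :: "'i fsupp \<Rightarrow> 'i fsupp" is "\<lambda>f i. \<i> * f i" by simp

declare imult.rep_eq [simp]

lemma linear_imult: "linear imult"
  by (rule linearI; rule fsupp_eqI) (simp_all only: imult.rep_eq coord_simps distrib_left mult_scaleR_right)

lemma imult_imult: "imult (imult f) = - f"
  by (rule fsupp_eqI) (simp only: imult.rep_eq coord_simps mult.assoc[symmetric], simp)

lemma inner_imult: "inner (imult f) g = - inner f (imult g)"
  unfolding inner_fsupp_def sum_negf[symmetric]
proof (rule sum.cong)
  show "{i. coord (imult f) i \<noteq> 0} = {i. coord f i \<noteq> 0}" by simp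
qed simp

section \<open>Matrices acting on one index\<close>

lemma fsupp_pair_eqI: "(\<And>i j. coord f (i, j) = coord g (i, j)) \<Longrightarrow> f = g"
  by (rule fsupp_eqI) (auto simp only: split_paired_all)

text \<open>Multiplication by a \<open>d \<times> d\<close> matrix in the first index; entries with first index at least \<open>d\<close>
  are discarded. On functions supported in the square of side \<open>d\<close> it is left multiplication.\<close>

lift_definition lmul :: "nat \<Rightarrow> (nat \<Rightarrow> nat \<Rightarrow> complex) \<Rightarrow> (nat \<times> 'j) fsupp \<Rightarrow> (nat \<times> 'j) fsupp"
  is "\<lambda>d M f p. if fst p < d then \<Sum>k<d. M (fst p) k * f (k, snd p) else 0"
proof -
  fix d and M :: "nat \<Rightarrow> nat \<Rightarrow> complex" and f :: "nat \<times> 'j \<Rightarrow> complex"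
  assume fin: "finite {p. f p \<noteq> 0}"
  let ?g = "\<lambda>p. if fst p < d then \<Sum>k<d. M (fst p) k * f (k, snd p) else 0"
  have "{p. ?g p \<noteq> 0} \<subseteq> {..<d} \<times> snd ` {p. f p \<noteq> 0}"
  proof
    fix p assume "p \<in> {p. ?g p \<noteq> 0}"
    then have p: "fst p < d" "(\<Sum>k<d. M (fst p) k * f (k, snd p)) \<noteq> 0"
      by (simp_all split: if_splits)
    from p(2) obtain k where "M (fst p) k * f (k, snd p) \<noteq> 0"
      by (rule sum.not_neutral_contains_not_neutral)
    then have "(k, snd p) \<in> {p. f p \<noteq> 0}" by simp
    then have "snd p \<in> snd ` {p. f p \<noteq> 0}" by (metis image_eqI snd_conv)
    then show "p \<in> {..<d} \<times> snd ` {p. f p \<noteq> 0}" using p(1) by (simp add: mem_Times_iff)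
  qed
  then show "finite {p. ?g p \<noteq> 0}"
    by (rule finite_subset) (use fin in simp)
qed

lemma coord_lmul: "coord (lmul d M f) (i, j) = (if i < d then \<Sum>k<d. M i k * coord f (k, j) else 0)"
  by (simp add: lmul.rep_eq)

lemma linear_lmul: "linear (lmul d M)"
proof (rule linearI)
  show "lmul d M (f + g) = lmul d M f + lmul d M g" for f g :: "(nat \<times> 'a) fsupp"
    by (rule fsupp_pair_eqI) (simp add: coord_lmul distrib_left sum.distrib)
  show "lmul d M (c *\<^sub>R f) = c *\<^sub>R lmul d M f" for c and f :: "(nat \<times> 'a) fsupp"
    by (rule fsupp_pair_eqI) (simp add: coord_lmul scaleR_sum_right)
qed

lemma lmul_imult: "lmul d M (imult f) = imult (lmul d M f)"
  by (rule fsupp_pair_eqI) (simp add: coord_lmul sum_distrib_left mult.left_commute)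

lemma inner_lmul:
  assumes herm: "\<And>i k. i < d \<Longrightarrow> k < d \<Longrightarrow> M i k = cnj (M k i)"
  shows "inner (lmul d M f) g = inner f (lmul d M g)"
proof -
  let ?J = "snd ` {p. coord f p \<noteq> 0} \<union> snd ` {p. coord g p \<noteq> 0}"
  have fin: "finite ({..<d} \<times> ?J)" using finite_coord[of f] finite_coord[of g] by simp
  have exp: "inner (lmul d M f) g = (\<Sum>j\<in>?J. \<Sum>i<d. \<Sum>k<d. Re (M i k * coord f (k, j) * cnj (coord g (i, j))))"
    if "snd ` {p. coord g p \<noteq> 0} \<subseteq> ?J" for f g
  proof -
    have "inner (lmul d M f) g = (\<Sum>p\<in>{..<d} \<times> ?J. Re (coord (lmul d M f) p * cnj (coord g p)))"
    proof (rule inner_fsupp_eq[OF fin])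
      fix p assume p: "coord (lmul d M f) p \<noteq> 0" "coord g p \<noteq> 0"
      have "fst p < d" using p(1) by (simp add: lmul.rep_eq split: if_splits)
      moreover have "snd p \<in> ?J" using p(2) that by blast
      ultimately show "p \<in> {..<d} \<times> ?J" by (simp add: mem_Times_iff)
    qed
    also have "\<dots> = (\<Sum>i<d. \<Sum>j\<in>?J. Re (coord (lmul d M f) (i, j) * cnj (coord g (i, j))))"
      by (simp add: sum.cartesian_product)
    also have "\<dots> = (\<Sum>i<d. \<Sum>j\<in>?J. \<Sum>k<d. Re (M i k * coord f (k, j) * cnj (coord g (i, j))))"
      by (intro sum.cong refl) (simp only: lessThan_iff coord_lmul if_True sum_distrib_right Re_sum)
    finally show ?thesis by (simp only: sum.swap[of _ ?J])
  qed
  have "inner (lmul d M f) g = (\<Sum>j\<in>?J. \<Sum>i<d. \<Sum>k<d. Re (M i k * coord f (k, j) * cnj (coord g (i, j))))"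
    by (rule exp) auto
  also have "\<dots> = (\<Sum>j\<in>?J. \<Sum>k<d. \<Sum>i<d. Re (M i k * coord f (k, j) * cnj (coord g (i, j))))"
    by (intro sum.cong refl sum.swap)
  also have "\<dots> = (\<Sum>j\<in>?J. \<Sum>k<d. \<Sum>i<d. Re (M k i * coord g (i, j) * cnj (coord f (k, j))))"
  proof (intro sum.cong refl)
    fix j i k assume "i \<in> {..<d}" "k \<in> {..<d}"
    then have "M i k * coord f (k, j) * cnj (coord g (i, j)) = cnj (M k i * coord g (i, j) * cnj (coord f (k, j)))"
      using herm[of i k] by (simp add: ac_simps)
    then show "Re (M i k * coord f (k, j) * cnj (coord g (i, j))) = Re (M k i * coord g (i, j) * cnj (coord f (k, j)))"
      by (metis complex_cnj(1) cnj.simps(1))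
  qed
  also have "\<dots> = inner (lmul d M g) f" by (rule exp[symmetric]) auto
  finally show ?thesis by (simp add: inner_commute)
qed

text \<open>Exchange of the two tensor factors; conjugating \<^const>\<open>lmul\<close> with it gives the action on the
  second factor.\<close>

lift_definition flip :: "('i \<times> 'j) fsupp \<Rightarrow> ('j \<times> 'i) fsupp" is "\<lambda>f p. f (prod.swap p)"
proof -
  fix f :: "'i \<times> 'j \<Rightarrow> complex"
  assume "finite {p. f p \<noteq> 0}"
  then show "finite {p. f (prod.swap p) \<noteq> 0}"
    using finite_vimageI[OF _ inj_swap, of "{p. f p \<noteq> 0}"] by (simp add: vimage_def)
qed

lemma coord_flip [simp]: "coord (flip f) (j, i) = coord f (i, j)"
  by (simp add: flip.rep_eq)

lemma flip_flip [simp]: "flip (flip f) = f"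
  by (rule fsupp_pair_eqI) simp

lemma linear_flip: "linear flip"
  by (rule linearI; rule fsupp_pair_eqI) simp_all

lemma inner_flip: "inner (flip f) (flip g) = inner f g"
proof -
  have "bij_betw prod.swap {p. coord (flip f) p \<noteq> 0} {p. coord f p \<noteq> 0}"
    by (rule bij_betw_byWitness[where f' = prod.swap]) (auto simp: flip.rep_eq)
  from sum.reindex_bij_betw[OF this, of "\<lambda>p. Re (coord f p * cnj (coord g p))"]
  show ?thesis unfolding inner_fsupp_def by (simp add: flip.rep_eq)
qed

lemma norm_flip: "norm (flip f) = norm f"
  by (simp add: norm_eq_sqrt_inner inner_flip)

lemma lmul_lmul: "lmul d M (lmul d N f) = lmul d (\<lambda>i k. \<Sum>l<d. M i l * N l k) f"
proof (rule fsupp_pair_eqI)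
  fix i and j :: 'a
  have "(\<Sum>l<d. M i l * (\<Sum>k<d. N l k * coord f (k, j))) = (\<Sum>l<d. \<Sum>k<d. M i l * N l k * coord f (k, j))"
    by (simp add: sum_distrib_left mult.assoc)
  also have "\<dots> = (\<Sum>k<d. (\<Sum>l<d. M i l * N l k) * coord f (k, j))"
    by (subst sum.swap) (simp add: sum_distrib_right)
  finally show "coord (lmul d M (lmul d N f)) (i, j) = coord (lmul d (\<lambda>i k. \<Sum>l<d. M i l * N l k) f) (i, j)"
    by (simp add: coord_lmul)
qed

lemma lmul_cong:
  assumes "\<And>i k. i < d \<Longrightarrow> k < d \<Longrightarrow> M i k = N i k"
  shows "lmul d M f = lmul d N f"
  by (rule fsupp_pair_eqI) (simp add: coord_lmul assms)

text \<open>The norms of the iterates of a self-adjoint map are log-convex by the Cauchy-Schwarz inequality. If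
  the first step expanded \<open>v\<close> by a factor \<open>q > 1\<close>, the norms would grow at least like \<open>q ^ n\<close>,
  against the polynomial bound.\<close>

lemma selfadjoint_contraction:
  fixes T :: "'a::real_inner \<Rightarrow> 'a"
  assumes adj: "\<And>v w. inner (T v) w = inner v (T w)"
    and growth: "\<And>n. norm ((T ^^ n) v) \<le> c1 + c2 * real n ^ k"
  shows "norm (T v) \<le> norm v"
proof (rule ccontr)
  assume "\<not> norm (T v) \<le> norm v"
  then have gt: "norm v < norm (T v)" by simp
  define a where "a n = norm ((T ^^ n) v)" for n
  have v0: "norm v > 0"
  proof (rule ccontr)
    assume "\<not> norm v > 0"
    then have "v = 0" by simp
    moreover have "inner (T 0) (T 0) = 0" using adj[of 0 "T 0"] by simp
    ultimately show False using gt by simp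
  qed
  define q where "q = norm (T v) / norm v"
  have q: "q > 1" using gt v0 by (simp add: q_def)
  have conv: "(a (Suc n))\<^sup>2 \<le> a n * a (Suc (Suc n))" for n
  proof -
    have "(a (Suc n))\<^sup>2 = inner ((T ^^ n) v) ((T ^^ Suc (Suc n)) v)"
      using adj[of "(T ^^ n) v" "(T ^^ Suc n) v"] by (simp add: a_def power2_norm_eq_inner)
    also have "\<dots> \<le> a n * a (Suc (Suc n))"
      unfolding a_def by (rule norm_cauchy_schwarz)
    finally show ?thesis .
  qed
  have step: "a n > 0 \<and> a (Suc n) \<ge> q * a n" for n
  proof (induction n)
    case 0
    then show ?case using v0 by (simp add: a_def q_def)
  next
    case (Suc n)
    then have n: "a n > 0" "a (Suc n) \<ge> q * a n" by auto
    then have pos: "a (Suc n) > 0" using q by (smt (verit) mult_pos_pos)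
    have "a n * (q * a (Suc n)) \<le> a (Suc n) * a (Suc n)"
      using mult_right_mono[OF n(2), of "a (Suc n)"] pos by (simp add: ac_simps)
    also have "\<dots> \<le> a n * a (Suc (Suc n))" using conv[of n] by (simp add: power2_eq_square)
    finally show ?case using n(1) pos by simp
  qed
  have lower: "q ^ n * a 0 \<le> a n" for n
  proof (induction n)
    case (Suc n)
    have "q ^ Suc n * a 0 = q * (q ^ n * a 0)" by simp
    also have "\<dots> \<le> q * a n" using Suc q by (intro mult_left_mono) auto
    also have "\<dots> \<le> a (Suc n)" using step by blast
    finally show ?case .
  qed simp
  have "((\<lambda>n. (c1 + c2 * real n ^ k) / q ^ n) \<longlongrightarrow> 0) sequentially"
    using q by real_asymp
  then have "\<forall>\<^sub>F n in sequentially. (c1 + c2 * real n ^ k) / q ^ n < a 0"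
    by (rule order_tendstoD(2)) (use v0 in \<open>simp add: a_def\<close>)
  then obtain n where "(c1 + c2 * real n ^ k) / q ^ n < a 0"
    by (auto simp: eventually_sequentially)
  then have "c1 + c2 * real n ^ k < q ^ n * a 0"
    using q by (simp add: divide_less_eq mult.commute)
  also have "\<dots> \<le> a n" by (rule lower)
  also have "\<dots> \<le> c1 + c2 * real n ^ k" unfolding a_def by (rule growth)
  finally show False by simp
qed

lemma hermitian_entry:
  assumes "A \<in> carrier_mat d d" "i < d" "k < d"
  shows "mat_adjoint A $$ (i, k) = cnj (A $$ (k, i))"
  using assms by (simp add: mat_adjoint_def mat_of_rows_def)

text \<open>The powers of a matrix with spectral radius at most one grow at most polynomially, by the Jordan
  normal form, and self-adjointness turns this growth bound into a norm bound.\<close>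

lemma lmul_contraction:
  fixes f :: "(nat \<times> 'j) fsupp"
  assumes X: "X \<in> carrier_mat d d" and herm: "hermitian X" and spec: "spectrum X \<subseteq> complex_of_real ` {-1..1}"
  shows "norm (lmul d (\<lambda>i k. X $$ (i, k)) f) \<le> norm f"
proof (cases "d = 0")
  case True
  then have "lmul d (\<lambda>i k. X $$ (i, k)) f = 0"
    by (intro fsupp_pair_eqI) (simp add: coord_lmul)
  then show ?thesis by simp
next
  case False
  let ?T = "lmul d (\<lambda>i k. X $$ (i, k)) :: (nat \<times> 'j) fsupp \<Rightarrow> _"
  have adj: "inner (?T v) w = inner v (?T w)" for v w
  proof (rule inner_lmul)
    fix i k assume "i < d" "k < d"
    then show "X $$ (i, k) = cnj (X $$ (k, i))"
      using hermitian_entry[OF X, of i k] herm by (simp add: hermitian_def)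
  qed
  have "spectral_radius X \<in> norm ` spectrum X" using spectral_radius_mem_max(1)[OF X] False by simp
  then obtain z where "spectral_radius X = norm z" "z \<in> complex_of_real ` {-1..1}" using spec by blast
  then have "spectral_radius X \<le> 1" by auto
  then obtain c1 c2 where bound: "\<And>n. norm_bound (X ^\<^sub>m n) (c1 + c2 * of_nat n ^ (d - 1))"
    using spectral_radius_jnf_norm_bound_le_1_upper_triangular[OF X] by blast
  define b where "b n = c1 + c2 * real n ^ (d - 1)" for n
  have pc: "X ^\<^sub>m n \<in> carrier_mat d d" for n using X by simp
  have entry: "cmod ((X ^\<^sub>m n) $$ (i, k)) \<le> b n" if "i < d" "k < d" for n i k
    using bound[of n, unfolded norm_bound_def carrier_matD[OF pc[of n]]] that by (simp add: b_def)
  have b0: "b n \<ge> 0" for n using entry[of 0 0 n] False norm_ge_zero order_trans by blast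
  have pow: "(?T ^^ Suc n) v = lmul d (\<lambda>i k. (X ^\<^sub>m Suc n) $$ (i, k)) v" for n v
  proof (induction n arbitrary: v)
    case 0
    show ?case by (simp add: X left_mult_one_mat[OF X])
  next
    case (Suc n)
    have "(?T ^^ Suc (Suc n)) v = (?T ^^ Suc n) (?T v)" by (simp add: funpow_swap1)
    also have "\<dots> = lmul d (\<lambda>i k. \<Sum>l<d. (X ^\<^sub>m Suc n) $$ (i, l) * X $$ (l, k)) v"
      unfolding Suc lmul_lmul ..
    also have "\<dots> = lmul d (\<lambda>i k. (X ^\<^sub>m Suc (Suc n)) $$ (i, k)) v"
    proof (rule lmul_cong)
      fix i k assume ik: "i < d" "k < d"
      have "(X ^\<^sub>m Suc (Suc n)) $$ (i, k) = (X ^\<^sub>m Suc n * X) $$ (i, k)" by simp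
      also have "\<dots> = (\<Sum>l<d. (X ^\<^sub>m Suc n) $$ (i, l) * X $$ (l, k))"
        using ik X pc[of "Suc n"]
        by (simp del: pow_mat.simps add: times_mat_def scalar_prod_def atLeast0LessThan)
      finally show "(\<Sum>l<d. (X ^\<^sub>m Suc n) $$ (i, l) * X $$ (l, k)) = (X ^\<^sub>m Suc (Suc n)) $$ (i, k)" ..
    qed
    finally show ?case .
  qed
  define J where "J = snd ` {p. coord f p \<noteq> 0}"
  have J: "finite J" unfolding J_def using finite_coord[of f] by simp
  define F where "F = (\<Sum>j\<in>J. \<Sum>k<d. cmod (coord f (k, j)))"
  define K where "K = sqrt (real d * real (card J)) * F"
  have F0: "F \<ge> 0" unfolding F_def by (intro sum_nonneg) auto
  have grow: "norm (lmul d (\<lambda>i k. (X ^\<^sub>m n) $$ (i, k)) f) \<le> K * b n" for n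
  proof -
    let ?g = "lmul d (\<lambda>i k. (X ^\<^sub>m n) $$ (i, k)) f"
    have c: "cmod (coord ?g (i, j)) \<le> b n * F" if "i < d" "j \<in> J" for i j
    proof -
      have "cmod (coord ?g (i, j)) \<le> (\<Sum>k<d. cmod ((X ^\<^sub>m n) $$ (i, k)) * cmod (coord f (k, j)))"
        using that by (auto simp: coord_lmul norm_mult intro: norm_sum[THEN order_trans])
      also have "\<dots> \<le> (\<Sum>k<d. b n * cmod (coord f (k, j)))"
        using entry that by (intro sum_mono mult_right_mono) auto
      also have "\<dots> = b n * (\<Sum>k<d. cmod (coord f (k, j)))" by (simp add: sum_distrib_left)
      also have "\<dots> \<le> b n * F"
        unfolding F_def using that J b0
        by (intro mult_left_mono member_le_sum[of j J "\<lambda>j. \<Sum>k<d. cmod (coord f (k, j))"]) (auto intro: sum_nonneg)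
      finally show ?thesis .
    qed
    have supp: "p \<in> {..<d} \<times> J" if "coord ?g p \<noteq> 0" for p
    proof -
      obtain i j where p: "p = (i, j)" by force
      then have "i < d" "(\<Sum>k<d. (X ^\<^sub>m n) $$ (i, k) * coord f (k, j)) \<noteq> 0"
        using that by (auto simp: coord_lmul split: if_splits)
      then obtain k where "(X ^\<^sub>m n) $$ (i, k) * coord f (k, j) \<noteq> 0"
        by (metis (no_types, lifting) sum.not_neutral_contains_not_neutral)
      then have "(k, j) \<in> {p. coord f p \<noteq> 0}" by simp
      then have "j \<in> J" unfolding J_def by (metis image_eqI snd_conv)
      then show ?thesis using p \<open>i < d\<close> by simp
    qed
    have "inner ?g ?g = (\<Sum>p\<in>{..<d} \<times> J. Re (coord ?g p * cnj (coord ?g p)))"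
      by (rule inner_fsupp_eq) (use J supp in auto)
    also have "\<dots> \<le> (\<Sum>p\<in>{..<d} \<times> J. (b n * F)\<^sup>2)"
    proof (rule sum_mono)
      fix p assume "p \<in> {..<d} \<times> J"
      then obtain i j where "p = (i, j)" "i < d" "j \<in> J" by auto
      then have "cmod (coord ?g p) \<le> b n * F" using c by simp
      then show "Re (coord ?g p * cnj (coord ?g p)) \<le> (b n * F)\<^sup>2"
        by (simp add: complex_norm_square[symmetric] power_mono)
    qed
    also have "\<dots> = (K * b n)\<^sup>2"
      by (simp add: K_def power_mult_distrib card_cartesian_product)
    finally have "norm ?g \<le> sqrt ((K * b n)\<^sup>2)" unfolding norm_eq_sqrt_inner by (rule real_sqrt_le_mono)
    moreover have "K * b n \<ge> 0" using b0 F0 by (simp add: K_def)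
    ultimately show ?thesis by simp
  qed
  have "norm ((?T ^^ n) f) \<le> (norm f + K * c1) + (K * c2) * real n ^ (d - 1)" for n
  proof (cases n)
    case 0
    have "K * b 0 \<ge> 0" using b0 F0 by (simp add: K_def)
    then show ?thesis using 0 by (simp add: b_def algebra_simps)
  next
    case (Suc m)
    have "norm ((?T ^^ n) f) \<le> K * b n" unfolding Suc pow by (rule grow)
    also have "\<dots> = K * c1 + (K * c2) * real n ^ (d - 1)"
      by (simp add: b_def distrib_left mult.assoc)
    finally show ?thesis using norm_ge_zero[of f] by linarith
  qed
  then show ?thesis by (rule selfadjoint_contraction[OF adj])
qed

section \<open>The lower bound on the local dimension\<close>

text \<open>Index \<open>i * n + j\<close> enumerates the pairs \<open>(i, j)\<close>, as in the definition of the tensor product.\<close>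

lemma sum_mult_index:
  fixes f :: "nat \<Rightarrow> 'a::comm_monoid_add"
  shows "(\<Sum>p<m * n. f p) = (\<Sum>i<m. \<Sum>j<n. f (i * n + j))"
proof -
  have "(\<Sum>j<n. f (i * n + j)) = sum f {i * n..<i * n + n}" for i
    using sum.shift_bounds_nat_ivl[of f 0 "i * n" n] by (simp add: atLeast0LessThan add.commute)
  then show ?thesis by (simp add: sum.nat_group)
qed

lift_definition bipartite :: "nat \<Rightarrow> complex Matrix.vec \<Rightarrow> (nat \<times> nat) fsupp"
  is "\<lambda>d v p. if fst p < d \<and> snd p < d then vec_index v (fst p * d + snd p) else 0"
proof -
  fix d and v :: "complex Matrix.vec"
  have "{p. (if fst p < d \<and> snd p < d then vec_index v (fst p * d + snd p) else 0) \<noteq> 0} \<subseteq> {..<d} \<times> {..<d}"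
    by (auto split: if_splits)
  then show "finite {p. (if fst p < d \<and> snd p < d then vec_index v (fst p * d + snd p) else 0) \<noteq> 0}"
    by (rule finite_subset) simp
qed

lemma coord_bipartite: "coord (bipartite d v) (i, j) = (if i < d \<and> j < d then vec_index v (i * d + j) else 0)"
  by (simp add: bipartite.rep_eq)

lemma inner_bipartite:
  assumes "w \<in> carrier_vec (d * d)"
  shows "inner (bipartite d v) (bipartite d w) = Re (v \<bullet>c w)"
proof -
  have "inner (bipartite d v) (bipartite d w)
      = (\<Sum>p\<in>{..<d} \<times> {..<d}. Re (coord (bipartite d v) p * cnj (coord (bipartite d w) p)))"
    by (rule inner_fsupp_eq) (auto simp: bipartite.rep_eq split: if_splits)
  also have "\<dots> = (\<Sum>i<d. \<Sum>j<d. Re (coord (bipartite d v) (i, j) * cnj (coord (bipartite d w) (i, j))))"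
    by (simp only: sum.cartesian_product split_def prod.collapse)
  also have "\<dots> = (\<Sum>i<d. \<Sum>j<d. Re (vec_index v (i * d + j) * cnj (vec_index w (i * d + j))))"
    by (intro sum.cong refl) (simp only: lessThan_iff coord_bipartite simp_thms if_True)
  also have "\<dots> = (\<Sum>p<d * d. Re (vec_index v p * cnj (vec_index w p)))"
    by (simp only: sum_mult_index)
  also have "\<dots> = Re (v \<bullet>c w)"
    using assms by (simp add: scalar_prod_def atLeast0LessThan)
  finally show ?thesis .
qed

lemma bipartite_index:
  assumes "i < d" "j < (d::nat)"
  shows "i * d + j < d * d" "(i * d + j) div d = i" "(i * d + j) mod d = j"
proof -
  have "i * d + j < Suc i * d" using assms by simp
  also have "\<dots> \<le> d * d" using assms by (intro mult_right_mono) auto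
  finally show "i * d + j < d * d" .
  show "(i * d + j) div d = i" "(i * d + j) mod d = j" using assms by simp_all
qed

lemma kronecker_mult_vec_index:
  fixes X Y :: "'a::comm_semiring_0 mat"
  assumes X: "X \<in> carrier_mat d d" and Y: "Y \<in> carrier_mat d d" and v: "v \<in> carrier_vec (d * d)"
    and ij: "i < d" "j < d"
  shows "vec_index ((X \<otimes>\<^sub>K Y) *\<^sub>v v) (i * d + j)
    = (\<Sum>k<d. \<Sum>l<d. X $$ (i, k) * Y $$ (j, l) * vec_index v (k * d + l))"
proof -
  have "vec_index ((X \<otimes>\<^sub>K Y) *\<^sub>v v) (i * d + j) = (\<Sum>q<d * d. (X \<otimes>\<^sub>K Y) $$ (i * d + j, q) * vec_index v q)"
    using X Y v bipartite_index[OF ij]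
    by (simp add: mult_mat_vec_def scalar_prod_def kronecker_def atLeast0LessThan)
  also have "\<dots> = (\<Sum>k<d. \<Sum>l<d. (X \<otimes>\<^sub>K Y) $$ (i * d + j, k * d + l) * vec_index v (k * d + l))"
    by (rule sum_mult_index)
  also have "\<dots> = (\<Sum>k<d. \<Sum>l<d. X $$ (i, k) * Y $$ (j, l) * vec_index v (k * d + l))"
  proof (intro sum.cong refl)
    fix k l assume "k \<in> {..<d}" "l \<in> {..<d}"
    then have kl: "k < d" "l < d" by auto
    show "(X \<otimes>\<^sub>K Y) $$ (i * d + j, k * d + l) * vec_index v (k * d + l)
      = X $$ (i, k) * Y $$ (j, l) * vec_index v (k * d + l)"
      using X Y bipartite_index[OF ij] bipartite_index[OF kl] by (simp add: kronecker_def)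
  qed
  finally show ?thesis .
qed

lemma bipartite_kronecker:
  assumes X: "X \<in> carrier_mat d d" and Y: "Y \<in> carrier_mat d d" and v: "v \<in> carrier_vec (d * d)"
  shows "bipartite d ((X \<otimes>\<^sub>K Y) *\<^sub>v v)
    = lmul d (\<lambda>i k. X $$ (i, k)) (flip (lmul d (\<lambda>j l. Y $$ (j, l)) (flip (bipartite d v))))"
proof (rule fsupp_pair_eqI)
  fix i j
  show "coord (bipartite d ((X \<otimes>\<^sub>K Y) *\<^sub>v v)) (i, j) =
    coord (lmul d (\<lambda>i k. X $$ (i, k)) (flip (lmul d (\<lambda>j l. Y $$ (j, l)) (flip (bipartite d v))))) (i, j)"
  proof (cases "i < d \<and> j < d")
    case True
    then show ?thesis
      using kronecker_mult_vec_index[OF X Y v]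
      by (simp add: coord_bipartite coord_lmul sum_distrib_left mult.assoc)
  next
    case False
    then show ?thesis by (auto simp: coord_bipartite coord_lmul)
  qed
qed

lemma lmul_flip_commute:
  "lmul d M (flip (lmul e N (flip f))) = flip (lmul e N (flip (lmul d M f)))"
proof (rule fsupp_pair_eqI)
  fix i j
  have "(\<Sum>k<d. M i k * (\<Sum>l<e. N j l * coord f (k, l))) = (\<Sum>l<e. N j l * (\<Sum>k<d. M i k * coord f (k, l)))"
    unfolding sum_distrib_left by (subst sum.swap) (simp add: mult.left_commute)
  then show "coord (lmul d M (flip (lmul e N (flip f)))) (i, j) = coord (flip (lmul e N (flip (lmul d M f)))) (i, j)"
    by (simp add: coord_lmul)
qed

lift_definition unit_at :: "'i \<Rightarrow> 'i fsupp" is "\<lambda>i k. if k = i then 1 else 0"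
  by (rule finite_subset[of _ "{_}"]) auto

text \<open>A map that commutes with every \<^const>\<open>lmul\<close> and moves a chosen column of the state to column
  zero, where only a copy of the \<open>d\<close>-dimensional first factor is left.\<close>

lift_definition column_to_first :: "nat \<Rightarrow> (nat \<times> nat) fsupp \<Rightarrow> (nat \<times> nat) fsupp"
  is "\<lambda>l f p. if snd p = 0 then f (fst p, l) else 0"
proof -
  fix l and f :: "nat \<times> nat \<Rightarrow> complex"
  assume fin: "finite {p. f p \<noteq> 0}"
  have "{p :: nat \<times> nat. (if snd p = 0 then f (fst p, l) else 0) \<noteq> 0} \<subseteq> (\<lambda>p. (fst p, 0)) ` {p. f p \<noteq> 0}"
    by (force split: if_splits)
  then show "finite {p :: nat \<times> nat. (if snd p = 0 then f (fst p, l) else 0) \<noteq> 0}"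
    by (rule finite_subset) (use fin in simp)
qed

lemma coord_column_to_first: "coord (column_to_first l f) (i, j) = (if j = 0 then coord f (i, l) else 0)"
  by (simp add: column_to_first.rep_eq)

definition column_space :: "nat \<Rightarrow> (nat \<times> nat) fsupp set" where
  "column_space d = {f. \<forall>i j. \<not> (i < d \<and> j = 0) \<longrightarrow> coord f (i, j) = 0}"

lemma subspace_column_space: "subspace (column_space d)"
  unfolding real_vector.subspace_def column_space_def by simp

lemma coord_sum: "coord (\<Sum>k\<in>A. g k) p = (\<Sum>k\<in>A. coord (g k) p)"
  by (induction A rule: infinite_finite_induct) simp_all

text \<open>The unit vectors of the column and their multiples by \<open>\<i>\<close> span it over the reals.\<close>

lemma card_column_space:
  assumes S: "S \<subseteq> column_space d" and ind: "independent S"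
  shows "card S \<le> 2 * d"
proof -
  let ?e = "\<lambda>i. unit_at (i, 0) :: (nat \<times> nat) fsupp"
  let ?T = "?e ` {..<d} \<union> (\<lambda>i. imult (?e i)) ` {..<d}"
  have "column_space d \<subseteq> span ?T"
  proof
    fix f assume f: "f \<in> column_space d"
    have "f = (\<Sum>i<d. Re (coord f (i, 0)) *\<^sub>R ?e i + Im (coord f (i, 0)) *\<^sub>R imult (?e i))"
    proof (rule fsupp_pair_eqI)
      fix k j
      have "coord (\<Sum>i<d. Re (coord f (i, 0)) *\<^sub>R ?e i + Im (coord f (i, 0)) *\<^sub>R imult (?e i)) (k, j)
          = (\<Sum>i<d. if i = k then if j = 0 then coord f (k, 0) else 0 else 0)"
        unfolding coord_sum
        by (rule sum.cong) (auto simp: unit_at.rep_eq complex_eq_iff)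
      also have "\<dots> = (if k < d \<and> j = 0 then coord f (k, 0) else 0)" by simp
      also have "\<dots> = coord f (k, j)" using f by (auto simp: column_space_def)
      finally show "coord f (k, j) = coord (\<Sum>i<d. Re (coord f (i, 0)) *\<^sub>R ?e i + Im (coord f (i, 0)) *\<^sub>R imult (?e i)) (k, j)"
        by (rule sym)
    qed
    also have "\<dots> \<in> span ?T"
      by (intro span_sum span_add span_scale span_base) auto
    finally show "f \<in> span ?T" .
  qed
  then have "card S \<le> card ?T"
    using independent_span_bound[OF _ ind, of ?T] S by auto
  also have "\<dots> \<le> card (?e ` {..<d}) + card ((\<lambda>i. imult (?e i)) ` {..<d})" by (rule card_Un_le)
  also have "\<dots> \<le> d + d" by (intro add_mono order_trans[OF card_image_le]) simp_all
  finally show ?thesis by simp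
qed

text \<open>The space \<open>V\<close> to which the Clifford relations are carried consists of the images of the state
  under all maps \<open>K\<close> that commute with the \<open>L s\<close> and take values in a single column. It is
  invariant under \<open>A i\<close> because \<open>A i (K \<Psi>) = K (A i \<Psi>) = K (B i \<Psi>)\<close> and \<open>K \<circ> B i\<close> is again
  such a map. A single column, as opposed to the whole tensor product, yields a bound linear
  in \<open>d\<close>.\<close>

lemma local_dimension_lower_bound:
  fixes C :: "real ^ 'n ^ 'm"
  assumes ext: "C extreme_point_of Cor" and rep: "tensor_operator_rep d C \<psi> X Y"
  shows "2 ^ (rank C div 2) \<le> d"
proof -
  have \<psi>: "\<psi> \<in> carrier_vec (d * d)" "\<psi> \<bullet>c \<psi> = 1"
    and X: "\<And>s. X s \<in> carrier_mat d d" "\<And>s. hermitian (X s)" "\<And>s. spectrum (X s) \<subseteq> complex_of_real ` {-1..1}"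
    and Y: "\<And>t. Y t \<in> carrier_mat d d" "\<And>t. hermitian (Y t)" "\<And>t. spectrum (Y t) \<subseteq> complex_of_real ` {-1..1}"
    and C: "\<And>s t. complex_of_real (C $ s $ t) = ((X s \<otimes>\<^sub>K Y t) *\<^sub>v \<psi>) \<bullet>c \<psi>"
    using rep by (auto simp: tensor_operator_rep_def)
  define \<Psi> where "\<Psi> = bipartite d \<psi>"
  define L where "L s = (lmul d (\<lambda>i k. X s $$ (i, k)) :: (nat \<times> nat) fsupp \<Rightarrow> _)" for s
  define R where "R t f = flip (lmul d (\<lambda>i k. Y t $$ (i, k)) (flip f))" for t and f :: "(nat \<times> nat) fsupp"
  have adj: "inner (lmul d (\<lambda>i k. Z $$ (i, k)) v) w = inner v (lmul d (\<lambda>i k. Z $$ (i, k)) w)"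
    if "Z \<in> carrier_mat d d" "hermitian Z" for Z and v w :: "(nat \<times> nat) fsupp"
  proof (rule inner_lmul)
    fix i k assume "i < d" "k < d"
    then show "Z $$ (i, k) = cnj (Z $$ (k, i))"
      using hermitian_entry[OF that(1), of i k] that(2) by (simp add: hermitian_def)
  qed
  interpret tensor_system C L R \<Psi>
  proof (rule tensor_system.intro)
    show "C extreme_point_of Cor" by (rule ext)
    show "linear (L s)" for s unfolding L_def by (rule linear_lmul)
    show "linear (R t)" for t
      using linear_compose[OF linear_compose[OF linear_flip linear_lmul] linear_flip]
      unfolding R_def o_def .
    show aL: "inner (L s v) w = inner v (L s w)" for s v w
      unfolding L_def by (rule adj[OF X(1,2)])
    show "inner (R t v) w = inner v (R t w)" for t v w
      using adj[OF Y(1,2), of t "flip v" "flip w"] inner_flip[of _ "flip w"] inner_flip[of "flip v"]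
      by (simp add: R_def)
    show "norm (L s v) \<le> norm v" for s v
      unfolding L_def by (rule lmul_contraction[OF X])
    show "norm (R t v) \<le> norm v" for t v
      using lmul_contraction[OF Y, of t "flip v"] by (simp add: R_def norm_flip)
    show comm: "L s (R t v) = R t (L s v)" for s t v
      unfolding L_def R_def by (rule lmul_flip_commute)
    show "norm \<Psi> = 1"
      using \<psi> by (simp add: \<Psi>_def norm_eq_sqrt_inner inner_bipartite)
    show "C $ s $ t = inner (L s \<Psi>) (R t \<Psi>)" for s t
    proof -
      have "C $ s $ t = Re (((X s \<otimes>\<^sub>K Y t) *\<^sub>v \<psi>) \<bullet>c \<psi>)" by (simp flip: C)
      also have "\<dots> = inner (L s (R t \<Psi>)) \<Psi>"
        unfolding L_def R_def \<Psi>_def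
        by (simp only: inner_bipartite[OF \<psi>(1), symmetric] bipartite_kronecker[OF X(1) Y(1) \<psi>(1)])
      also have "\<dots> = inner (L s \<Psi>) (R t \<Psi>)" by (subst aL) (rule inner_commute)
      finally show ?thesis .
    qed
  qed
  let ?r = "rank C"
  obtain a b
    where ab: "\<And>i. i < ?r \<Longrightarrow> (\<Sum>s\<in>UNIV. a i s *\<^sub>R L s \<Psi>) = (\<Sum>t\<in>UNIV. b i t *\<^sub>R R t \<Psi>)"
    and sq: "\<And>i. i < ?r \<Longrightarrow> (\<Sum>s\<in>UNIV. a i s *\<^sub>R L s (\<Sum>s\<in>UNIV. a i s *\<^sub>R L s \<Psi>)) = \<Psi>"
    and anti: "\<And>i j. i < ?r \<Longrightarrow> j < ?r \<Longrightarrow> i \<noteq> j \<Longrightarrow>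
      (\<Sum>s\<in>UNIV. a i s *\<^sub>R L s (\<Sum>s\<in>UNIV. a j s *\<^sub>R L s \<Psi>)) =
      - (\<Sum>s\<in>UNIV. a j s *\<^sub>R L s (\<Sum>s\<in>UNIV. a i s *\<^sub>R L s \<Psi>))"
    by (rule clifford_relations) (rule that)
  define A where "A i v = (\<Sum>s\<in>UNIV. a i s *\<^sub>R L s v)" for i v
  define B where "B i v = (\<Sum>t\<in>UNIV. b i t *\<^sub>R R t v)" for i v
  have AB: "A i \<Psi> = B i \<Psi>" if "i < ?r" for i using ab[OF that] by (simp add: A_def B_def)
  have AA: "A i (A i \<Psi>) = \<Psi>" if "i < ?r" for i using sq[OF that] by (simp add: A_def)
  have Aanti: "A i (A j \<Psi>) = - A j (A i \<Psi>)" if "i < ?r" "j < ?r" "i \<noteq> j" for i j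
    using anti[OF that] by (simp add: A_def)
  have linA: "linear (A i)" for i
    unfolding A_def by (intro linear_compose_sum ballI linear_compose_scale_right linL)
  have linB: "linear (B i)" for i
    unfolding B_def by (intro linear_compose_sum ballI linear_compose_scale_right linR)
  have BL: "B i (L s v) = L s (B i v)" for i s v
    by (simp add: B_def comm linear_sum[OF linL] linear_cmul[OF linL])
  define \<K> where "\<K> = {K. linear K \<and> (\<forall>s v. K (L s v) = L s (K v)) \<and> (\<forall>v. K v \<in> column_space d)}"
  define V where "V = (\<lambda>K. K \<Psi>) ` \<K>"
  have KA: "K (A i v) = A i (K v)" if "K \<in> \<K>" for K i v
    using that by (simp add: \<K>_def A_def linear_sum linear_cmul)
  have VI: "K \<Psi> \<in> V" if "K \<in> \<K>" for K using that by (simp add: V_def)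
  have sub: "subspace V"
  proof (rule real_vector.subspaceI)
    have "(\<lambda>_. 0) \<in> \<K>"
      using real_vector.subspace_0[OF subspace_column_space] by (auto simp: \<K>_def linear_0[OF linL] linear_zero)
    from VI[OF this] show "0 \<in> V" .
  next
    fix v w assume "v \<in> V" "w \<in> V"
    then obtain K K' where K: "K \<in> \<K>" "v = K \<Psi>" "K' \<in> \<K>" "w = K' \<Psi>" by (auto simp: V_def)
    have "(\<lambda>f. K f + K' f) \<in> \<K>"
      using K(1,3) real_vector.subspace_add[OF subspace_column_space]
      by (auto simp: \<K>_def linear_add[OF linL] intro: linear_compose_add)
    from VI[OF this] show "v + w \<in> V" by (simp add: K)
  next
    fix c v assume "v \<in> V"
    then obtain K where K: "K \<in> \<K>" "v = K \<Psi>" by (auto simp: V_def)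
    have "(\<lambda>f. c *\<^sub>R K f) \<in> \<K>"
      using K(1) real_vector.subspace_scale[OF subspace_column_space]
      by (auto simp: \<K>_def linear_cmul[OF linL] intro: linear_compose_scale_right)
    from VI[OF this] show "c *\<^sub>R v \<in> V" by (simp add: K)
  qed
  have VJ: "imult v \<in> V" if v: "v \<in> V" for v
  proof -
    obtain K where K: "K \<in> \<K>" "v = K \<Psi>" using v by (auto simp: V_def)
    have "(\<lambda>f. imult (K f)) \<in> \<K>"
      using K(1) linear_compose[OF _ linear_imult, of K]
      by (auto simp: \<K>_def L_def lmul_imult o_def column_space_def)
    from VI[OF this] show ?thesis by (simp add: K)
  qed
  have VA: "A i v \<in> V" if i: "i < ?r" and v: "v \<in> V" for i v
  proof -
    obtain K where K: "K \<in> \<K>" "v = K \<Psi>" using v by (auto simp: V_def)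
    have "(\<lambda>f. K (B i f)) \<in> \<K>"
      using K(1) linear_compose[OF linB, of K] by (auto simp: \<K>_def BL o_def)
    from VI[OF this] show ?thesis using K KA AB i by simp
  qed
  have "V \<noteq> {0}"
  proof -
    have "\<Psi> \<noteq> 0" using unit by auto
    then obtain k l where kl: "coord \<Psi> (k, l) \<noteq> 0"
      using fsupp_pair_eqI[of \<Psi> 0] by auto
    have zero: "coord \<Psi> (i, l) = 0" if "\<not> i < d" for i using that by (simp add: \<Psi>_def coord_bipartite)
    \<comment> \<open>Multiplication by the identity matrix cuts off the entries outside the first d rows.\<close>
    let ?K = "\<lambda>f. lmul d (\<lambda>i k. if k = i then 1 else 0) (column_to_first l f)"
    have coordK: "coord (?K f) (i, j) = (if i < d \<and> j = 0 then coord f (i, l) else 0)" for f i j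
    proof -
      have "(\<Sum>k<d. (if k = i then 1 else 0) * coord (column_to_first l f) (k, j))
          = (\<Sum>k<d. if k = i then coord (column_to_first l f) (k, j) else 0)"
        by (rule sum.cong) auto
      then have e: "(\<Sum>k<d. (if k = i then 1 else 0) * coord (column_to_first l f) (k, j))
          = (if i < d then coord (column_to_first l f) (i, j) else 0)" by simp
      show ?thesis unfolding coord_lmul e by (simp add: coord_column_to_first)
    qed
    have "?K \<in> \<K>"
      unfolding \<K>_def
    proof (intro CollectI conjI allI)
      show "linear ?K" by (rule linearI; rule fsupp_pair_eqI) (simp_all add: coordK)
      show "?K (L s v) = L s (?K v)" for s v
        by (rule fsupp_pair_eqI)
          (simp only: coordK L_def coord_lmul[of d "\<lambda>i k. X s $$ (i, k)"], auto intro!: sum.cong)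
      show "?K v \<in> column_space d" for v by (simp add: column_space_def coordK)
    qed
    moreover have "?K \<Psi> \<noteq> 0"
    proof
      assume "?K \<Psi> = 0"
      then have "coord (?K \<Psi>) (k, 0) = 0" by simp
      then show False using kl zero[of k] unfolding coordK by (auto split: if_splits)
    qed
    ultimately show ?thesis using VI[of ?K] by blast
  qed
  moreover have "A i (imult v) = imult (A i v)" for i v
    by (simp add: A_def L_def lmul_imult linear_sum[OF linear_imult] linear_cmul[OF linear_imult])
  moreover have "A i (A i v) = v" if "i < ?r" "v \<in> V" for i v
    using that AA KA by (auto simp: V_def simp flip: KA)
  moreover have "A i (A j v) = - A j (A i v)" if ij: "i < ?r" "j < ?r" "i \<noteq> j" and v: "v \<in> V" for i j v
  proof -
    obtain K where K: "K \<in> \<K>" "v = K \<Psi>" using v by (auto simp: V_def)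
    then have "linear K" by (simp add: \<K>_def)
    have "A i (A j v) = K (A i (A j \<Psi>))" using K by (simp add: KA)
    also have "\<dots> = - K (A j (A i \<Psi>))" using Aanti[OF ij] linear_neg[OF \<open>linear K\<close>] by simp
    also have "\<dots> = - A j (A i v)" using K by (simp add: KA)
    finally show ?thesis .
  qed
  moreover have "inner (A i v) w = inner v (A i w)" for i v w
    by (simp add: A_def inner_sum_left inner_sum_right adjL)
  ultimately obtain S where S: "S \<subseteq> V" "card S = 2 * 2 ^ (?r div 2)" "pairwise orthogonal S" "0 \<notin> S"
    using clifford_orthogonal_family[of imult A V ?r, OF linear_imult imult_imult inner_imult linA]
      sub VJ VA by blast
  have "V \<subseteq> column_space d" by (auto simp: V_def \<K>_def)
  then have "card S \<le> 2 * d"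
    using S pairwise_orthogonal_independent by (intro card_column_space) auto
  then show ?thesis using S(2) by simp
qed

section \<open>Anticommuting Hermitian matrices\<close>

text \<open>Square matrices given by their entry functions: \<open>fmult d\<close> is the product of \<open>d \<times> d\<close> matrices,
  and \<open>ftensor d\<close> is the Kronecker product with a second factor of size \<open>d\<close>.\<close>

definition fmult :: "nat \<Rightarrow> (nat \<Rightarrow> nat \<Rightarrow> complex) \<Rightarrow> (nat \<Rightarrow> nat \<Rightarrow> complex) \<Rightarrow> nat \<Rightarrow> nat \<Rightarrow> complex" where
  "fmult d g h p q = (\<Sum>r<d. g p r * h r q)"

definition ftensor :: "nat \<Rightarrow> (nat \<Rightarrow> nat \<Rightarrow> complex) \<Rightarrow> (nat \<Rightarrow> nat \<Rightarrow> complex) \<Rightarrow> nat \<Rightarrow> nat \<Rightarrow> complex" where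
  "ftensor d \<sigma> g p q = \<sigma> (p div d) (q div d) * g (p mod d) (q mod d)"

lemma fmult_ftensor: "fmult (2 * d) (ftensor d \<sigma> g) (ftensor d \<tau> h) p q = fmult 2 \<sigma> \<tau> (p div d) (q div d) * fmult d g h (p mod d) (q mod d)"
proof -
  have "fmult (2 * d) (ftensor d \<sigma> g) (ftensor d \<tau> h) p q = (\<Sum>a<2. \<Sum>r<d.
      ftensor d \<sigma> g p (a * d + r) * ftensor d \<tau> h (a * d + r) q)"
    unfolding fmult_def by (rule sum_mult_index)
  also have "\<dots> = (\<Sum>a<2. \<Sum>r<d. (\<sigma> (p div d) a * \<tau> a (q div d)) * (g (p mod d) r * h r (q mod d)))"
    by (intro sum.cong refl) (simp add: ftensor_def)
  also have "\<dots> = (\<Sum>a<2. \<sigma> (p div d) a * \<tau> a (q div d)) * (\<Sum>r<d. g (p mod d) r * h r (q mod d))"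
    by (simp only: sum_product)
  finally show ?thesis by (simp add: fmult_def)
qed

definition fone :: "nat \<Rightarrow> nat \<Rightarrow> complex" where "fone p q = (if p = q then 1 else 0)"
definition pauli_x :: "nat \<Rightarrow> nat \<Rightarrow> complex" where "pauli_x a b = (if a = b then 0 else 1)"
definition pauli_y :: "nat \<Rightarrow> nat \<Rightarrow> complex" where
  "pauli_y a b = (if a = b then 0 else if a < b then - \<i> else \<i>)"
definition pauli_z :: "nat \<Rightarrow> nat \<Rightarrow> complex" where
  "pauli_z a b = (if a = b then if a = 0 then 1 else - 1 else 0)"

lemma pauli_mult:
  assumes "a < 2" "b < 2"
  shows "fmult 2 pauli_x pauli_x a b = fone a b" "fmult 2 pauli_y pauli_y a b = fone a b"
    "fmult 2 pauli_z pauli_z a b = fone a b"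
    "fmult 2 pauli_y pauli_x a b = - fmult 2 pauli_x pauli_y a b"
    "fmult 2 pauli_z pauli_x a b = - fmult 2 pauli_x pauli_z a b"
    "fmult 2 pauli_z pauli_y a b = - fmult 2 pauli_y pauli_z a b"
proof -
  have mm2: "fmult 2 \<sigma> \<tau> a b = \<sigma> a 0 * \<tau> 0 b + \<sigma> a 1 * \<tau> 1 b" for \<sigma> \<tau>
    by (simp add: fmult_def numeral_2_eq_2)
  have "a = 0 \<or> a = 1" "b = 0 \<or> b = 1" using assms by auto
  then show "fmult 2 pauli_x pauli_x a b = fone a b" "fmult 2 pauli_y pauli_y a b = fone a b"
    "fmult 2 pauli_z pauli_z a b = fone a b"
    "fmult 2 pauli_y pauli_x a b = - fmult 2 pauli_x pauli_y a b"
    "fmult 2 pauli_z pauli_x a b = - fmult 2 pauli_x pauli_z a b"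
    "fmult 2 pauli_z pauli_y a b = - fmult 2 pauli_y pauli_z a b"
    unfolding mm2 pauli_x_def pauli_y_def pauli_z_def fone_def by (elim disjE; simp)+
qed

lemma fmult_fone:
  assumes "p < d" "q < d"
  shows "fmult d fone g p q = g p q" "fmult d g fone p q = g p q"
proof -
  have "fmult d fone g p q = (\<Sum>r<d. if r = p then g r q else 0)"
    unfolding fmult_def fone_def by (rule sum.cong) auto
  then show "fmult d fone g p q = g p q" using assms by simp
  have "fmult d g fone p q = (\<Sum>r<d. if r = q then g p r else 0)"
    unfolding fmult_def fone_def by (rule sum.cong) auto
  then show "fmult d g fone p q = g p q" using assms by simp
qed

text \<open>The induction step passes from \<open>g 0, \<dots>, g (2 k)\<close> in dimension \<open>2 ^ k\<close> to the Kronecker products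
  \<open>\<sigma>\<^sub>x \<otimes> g i\<close>, \<open>\<sigma>\<^sub>y \<otimes> 1\<close> and \<open>\<sigma>\<^sub>z \<otimes> 1\<close>, which are two more generators in twice the dimension.\<close>

lemma clifford_generators:
  "\<exists>g :: nat \<Rightarrow> nat \<Rightarrow> nat \<Rightarrow> complex.
    (\<forall>i<2 * k + 1. \<forall>p q. g i q p = cnj (g i p q)) \<and>
    (\<forall>i<2 * k + 1. \<forall>j<2 * k + 1. \<forall>p<2 ^ k. \<forall>q<2 ^ k.
      fmult (2 ^ k) (g i) (g j) p q + fmult (2 ^ k) (g j) (g i) p q = (if i = j \<and> p = q then 2 else 0))"
proof (induction k)
  case 0
  show ?case by (rule exI[of _ "\<lambda>_ _ _. 1"]) (simp add: fmult_def)
next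
  case (Suc k)
  then obtain g :: "nat \<Rightarrow> nat \<Rightarrow> nat \<Rightarrow> complex" where
    herm: "\<And>i p q. i < 2 * k + 1 \<Longrightarrow> g i q p = cnj (g i p q)" and
    anti: "\<And>i j p q. i < 2 * k + 1 \<Longrightarrow> j < 2 * k + 1 \<Longrightarrow> p < 2 ^ k \<Longrightarrow> q < 2 ^ k \<Longrightarrow>
      fmult (2 ^ k) (g i) (g j) p q + fmult (2 ^ k) (g j) (g i) p q = (if i = j \<and> p = q then 2 else 0)"
    by blast
  define d :: nat where "d = 2 ^ k"
  have d0: "d > 0" by (simp add: d_def)
  define x where "x i = ftensor d pauli_x (g i)" for i
  define y where "y = ftensor d pauli_y fone"
  define z where "z = ftensor d pauli_z fone"
  define G where "G i = (if i < 2 * k + 1 then x i else if i = 2 * k + 1 then y else z)" for i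
  have eq: "fone (p div d) (q div d) * fone (p mod d) (q mod d) = fone p q" for p q
  proof -
    have "p = q" if "p div d = q div d" "p mod d = q mod d"
      using that by (metis div_mult_mod_eq)
    then show ?thesis by (auto simp: fone_def)
  qed
  have hG: "G i q p = cnj (G i p q)" if "i < 2 * Suc k + 1" for i p q
  proof -
    have "x i q p = cnj (x i p q)" if "i < 2 * k + 1" for i
      using herm[OF that, of "q mod d" "p mod d"] by (simp add: x_def ftensor_def pauli_x_def)
    moreover have "y q p = cnj (y p q)" "z q p = cnj (z p q)"
      by (auto simp: y_def z_def ftensor_def pauli_y_def pauli_z_def fone_def)
    ultimately show ?thesis by (simp add: G_def)
  qed
  have aG: "fmult (2 * d) (G i) (G j) p q + fmult (2 * d) (G j) (G i) p q = (if i = j then 2 * fone p q else 0)"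
    if ij: "i < 2 * Suc k + 1" "j < 2 * Suc k + 1" and pq: "p < 2 * d" "q < 2 * d" for i j p q
  proof -
    have lt: "p div d < 2" "q div d < 2" "p mod d < d" "q mod d < d"
      using pq d0 by (simp_all add: less_mult_imp_div_less)
    note P = pauli_mult[OF lt(1,2)] and I = fmult_fone[OF lt(3,4)]
    have xx: "fmult (2 * d) (x i) (x j) p q + fmult (2 * d) (x j) (x i) p q = (if i = j then 2 * fone p q else 0)"
      if "i < 2 * k + 1" "j < 2 * k + 1" for i j
    proof -
      have "fmult (2 * d) (x i) (x j) p q + fmult (2 * d) (x j) (x i) p q
        = fone (p div d) (q div d) * (fmult d (g i) (g j) (p mod d) (q mod d) + fmult d (g j) (g i) (p mod d) (q mod d))"
        by (simp add: x_def fmult_ftensor P distrib_left)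
      also have "\<dots> = fone (p div d) (q div d) * (if i = j then 2 * fone (p mod d) (q mod d) else 0)"
        using anti[OF that, of "p mod d" "q mod d"] lt by (simp add: d_def[symmetric] fone_def)
      finally show ?thesis by (simp add: eq[of p q, symmetric] mult.left_commute)
    qed
    have yy: "fmult (2 * d) y y p q = fone p q" and zz: "fmult (2 * d) z z p q = fone p q"
      by (simp_all add: y_def z_def fmult_ftensor P I eq)
    have xy: "fmult (2 * d) (x i) y p q + fmult (2 * d) y (x i) p q = 0"
      and xz: "fmult (2 * d) (x i) z p q + fmult (2 * d) z (x i) p q = 0" for i
      by (simp_all add: x_def y_def z_def fmult_ftensor P I)
    have yz: "fmult (2 * d) y z p q + fmult (2 * d) z y p q = 0"
      by (simp add: y_def z_def fmult_ftensor P I)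
    have *: "i < 2 * k + 1 \<or> i = 2 * k + 1 \<or> i = 2 * k + 2"
      "j < 2 * k + 1 \<or> j = 2 * k + 1 \<or> j = 2 * k + 2" using ij by auto
    have yx: "fmult (2 * d) y (x i) p q + fmult (2 * d) (x i) y p q = 0"
      and zx: "fmult (2 * d) z (x i) p q + fmult (2 * d) (x i) z p q = 0"
      and zy: "fmult (2 * d) z y p q + fmult (2 * d) y z p q = 0" for i
      by (rule trans[OF add.commute], rule xy xz yz)+
    show ?thesis
      using * by (elim disjE) (auto simp: G_def xx xy yx xz zx yz zy yy zz)
  qed
  show ?case
  proof (intro exI conjI allI impI)
    show "G i q p = cnj (G i p q)" if "i < 2 * Suc k + 1" for i p q by (rule hG[OF that])
    show "fmult (2 ^ Suc k) (G i) (G j) p q + fmult (2 ^ Suc k) (G j) (G i) p q = (if i = j \<and> p = q then 2 else 0)"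
      if "i < 2 * Suc k + 1" "j < 2 * Suc k + 1" "p < 2 ^ Suc k" "q < 2 ^ Suc k" for i j p q
      using aG[of i j p q] that by (simp add: d_def fone_def)
  qed
qed

locale clifford_family =
  fixes d r :: nat and g :: "nat \<Rightarrow> nat \<Rightarrow> nat \<Rightarrow> complex"
  assumes herm: "\<And>i p q. i < r \<Longrightarrow> g i q p = cnj (g i p q)"
    and anti: "\<And>i j p q. i < r \<Longrightarrow> j < r \<Longrightarrow> p < d \<Longrightarrow> q < d \<Longrightarrow>
      fmult d (g i) (g j) p q + fmult d (g j) (g i) p q = (if i = j \<and> p = q then 2 else 0)"
begin

definition clifford_vector :: "(nat \<Rightarrow> real) \<Rightarrow> complex mat" where
  "clifford_vector \<xi> = mat d d (\<lambda>(p, q). \<Sum>i<r. complex_of_real (\<xi> i) * g i p q)"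

lemma clifford_vector_carrier: "clifford_vector \<xi> \<in> carrier_mat d d"
  by (simp add: clifford_vector_def)

lemma clifford_vector_adjoint:
  assumes "p < d" "q < d"
  shows "clifford_vector \<xi> $$ (q, p) = cnj (clifford_vector \<xi> $$ (p, q))"
  using assms by (simp add: clifford_vector_def herm[of _ q p])

lemma clifford_vector_anticommute:
  assumes pq: "p < d" "q < d"
  shows "(\<Sum>k<d. clifford_vector \<xi> $$ (p, k) * clifford_vector \<eta> $$ (k, q))
    + (\<Sum>k<d. clifford_vector \<eta> $$ (p, k) * clifford_vector \<xi> $$ (k, q))
    = (if p = q then 2 * complex_of_real (\<Sum>i<r. \<xi> i * \<eta> i) else 0)"
proof -
  have e: "(\<Sum>k<d. clifford_vector \<xi> $$ (p, k) * clifford_vector \<eta> $$ (k, q))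
      = (\<Sum>i<r. \<Sum>j<r. complex_of_real (\<xi> i * \<eta> j) * fmult d (g i) (g j) p q)" for \<xi> \<eta>
  proof -
    have "(\<Sum>k<d. clifford_vector \<xi> $$ (p, k) * clifford_vector \<eta> $$ (k, q))
      = (\<Sum>k<d. \<Sum>i<r. \<Sum>j<r. complex_of_real (\<xi> i * \<eta> j) * (g i p k * g j k q))"
    proof (rule sum.cong[OF refl])
      fix k assume "k \<in> {..<d}"
      then have "clifford_vector \<xi> $$ (p, k) * clifford_vector \<eta> $$ (k, q)
        = (\<Sum>i<r. complex_of_real (\<xi> i) * g i p k) * (\<Sum>j<r. complex_of_real (\<eta> j) * g j k q)"
        using pq by (simp add: clifford_vector_def)
      also have "\<dots> = (\<Sum>i<r. \<Sum>j<r. complex_of_real (\<xi> i * \<eta> j) * (g i p k * g j k q))"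
        unfolding sum_product by (intro sum.cong refl) simp
      finally show "clifford_vector \<xi> $$ (p, k) * clifford_vector \<eta> $$ (k, q)
        = (\<Sum>i<r. \<Sum>j<r. complex_of_real (\<xi> i * \<eta> j) * (g i p k * g j k q))" .
    qed
    also have "\<dots> = (\<Sum>i<r. \<Sum>k<d. \<Sum>j<r. complex_of_real (\<xi> i * \<eta> j) * (g i p k * g j k q))"
      by (rule sum.swap)
    also have "\<dots> = (\<Sum>i<r. \<Sum>j<r. \<Sum>k<d. complex_of_real (\<xi> i * \<eta> j) * (g i p k * g j k q))"
      by (rule sum.cong[OF refl], rule sum.swap)
    finally show ?thesis by (simp only: fmult_def sum_distrib_left)
  qed
  have "(\<Sum>k<d. clifford_vector \<eta> $$ (p, k) * clifford_vector \<xi> $$ (k, q))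
      = (\<Sum>i<r. \<Sum>j<r. complex_of_real (\<xi> i * \<eta> j) * fmult d (g j) (g i) p q)"
    unfolding e by (subst sum.swap) (simp add: mult.commute)
  then have "(\<Sum>k<d. clifford_vector \<xi> $$ (p, k) * clifford_vector \<eta> $$ (k, q))
    + (\<Sum>k<d. clifford_vector \<eta> $$ (p, k) * clifford_vector \<xi> $$ (k, q))
    = (\<Sum>i<r. \<Sum>j<r. complex_of_real (\<xi> i * \<eta> j) * (fmult d (g i) (g j) p q + fmult d (g j) (g i) p q))"
    unfolding e[of \<xi> \<eta>] by (simp only: distrib_left sum.distrib)
  also have "\<dots> = (\<Sum>i<r. \<Sum>j<r. if j = i then complex_of_real (\<xi> i * \<eta> j) * (if p = q then 2 else 0) else 0)"
    using anti pq by (intro sum.cong refl) auto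
  also have "\<dots> = (\<Sum>i<r. complex_of_real (\<xi> i * \<eta> i) * (if p = q then 2 else 0))"
    by (intro sum.cong refl) simp
  also have "\<dots> = (if p = q then 2 * complex_of_real (\<Sum>i<r. \<xi> i * \<eta> i) else 0)"
    by (simp add: sum_distrib_left mult.commute)
  finally show ?thesis .
qed

lemma clifford_vector_hermitian: "hermitian (clifford_vector \<xi>)"
  unfolding hermitian_def
proof (rule eq_matI)
  let ?A = "clifford_vector \<xi>"
  have c: "?A \<in> carrier_mat d d" by (rule clifford_vector_carrier)
  show "mat_adjoint ?A $$ (i, j) = ?A $$ (i, j)" if "i < dim_row ?A" "j < dim_col ?A" for i j
    using that c hermitian_entry[OF c, of i j] clifford_vector_adjoint[of j i \<xi>] by simp
qed (simp_all add: clifford_vector_def mat_adjoint_def)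

lemma clifford_vector_square:
  assumes "(\<Sum>i<r. \<xi> i * \<xi> i) = 1"
  shows "clifford_vector \<xi> * clifford_vector \<xi> = 1\<^sub>m d"
proof (rule eq_matI)
  fix i j assume "i < dim_row (1\<^sub>m d)" "j < dim_col (1\<^sub>m d)"
  then have ij: "i < d" "j < d" by auto
  have c: "clifford_vector \<xi> \<in> carrier_mat d d" by (rule clifford_vector_carrier)
  have "(clifford_vector \<xi> * clifford_vector \<xi>) $$ (i, j)
      = (\<Sum>k<d. clifford_vector \<xi> $$ (i, k) * clifford_vector \<xi> $$ (k, j))"
    using ij c by (simp add: times_mat_def scalar_prod_def atLeast0LessThan)
  then show "(clifford_vector \<xi> * clifford_vector \<xi>) $$ (i, j) = 1\<^sub>m d $$ (i, j)"
    using clifford_vector_anticommute[OF ij, of \<xi> \<xi>] assms ij by (auto split: if_splits)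
qed (simp_all add: clifford_vector_def)

text \<open>Taking the trace of the anticommutator counts the trace of the product twice.\<close>

lemma clifford_vector_trace:
  "(\<Sum>p<d. \<Sum>q<d. clifford_vector \<xi> $$ (p, q) * clifford_vector \<eta> $$ (q, p))
    = of_nat d * complex_of_real (\<Sum>i<r. \<xi> i * \<eta> i)"
proof -
  let ?t = "\<lambda>\<xi> \<eta>. \<Sum>p<d. \<Sum>q<d. clifford_vector \<xi> $$ (p, q) * clifford_vector \<eta> $$ (q, p)"
  have sym: "?t \<eta> \<xi> = ?t \<xi> \<eta>"
    by (subst sum.swap) (simp add: mult.commute)
  have "?t \<xi> \<eta> + ?t \<eta> \<xi> = (\<Sum>p<d. 2 * complex_of_real (\<Sum>i<r. \<xi> i * \<eta> i))"
    unfolding sum.distrib[symmetric]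
    by (intro sum.cong refl) (simp add: clifford_vector_anticommute sum.distrib)
  then show ?thesis unfolding sym by simp
qed

end

section \<open>The upper bound on the local dimension\<close>

lemma spectrum_of_involution:
  fixes A :: "complex mat"
  assumes A: "A \<in> carrier_mat d d" and AA: "A * A = 1\<^sub>m d"
  shows "spectrum A \<subseteq> complex_of_real ` {-1..1}"
proof
  fix c assume "c \<in> spectrum A"
  then obtain v where v: "v \<in> carrier_vec d" "v \<noteq> 0\<^sub>v d" "A *\<^sub>v v = c \<cdot>\<^sub>v v"
    using A by (auto simp: spectrum_def eigenvalue_def eigenvector_def)
  have "v = (A * A) *\<^sub>v v" using AA v(1) by simp
  also have "\<dots> = A *\<^sub>v (A *\<^sub>v v)" by (rule assoc_mult_mat_vec[OF A A v(1)])
  also have "\<dots> = (c * c) \<cdot>\<^sub>v v"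
    using A v by (simp add: mult_mat_vec smult_smult_assoc)
  finally have eq: "v = (c * c) \<cdot>\<^sub>v v" .
  obtain i where i: "i < d" "vec_index v i \<noteq> 0"
    using v(1,2) by (metis carrier_vecD eq_vecI index_zero_vec(1,2))
  have "vec_index v i = c * c * vec_index v i"
    using arg_cong[OF eq, of "\<lambda>w. vec_index w i"] i v(1) by simp
  then have "c * c = 1" using i by simp
  then have "c = 1 \<or> c = - 1" by (simp add: square_eq_1_iff)
  then show "c \<in> complex_of_real ` {-1..1}"
    by (auto intro: image_eqI[of _ _ 1] image_eqI[of _ _ "-1"])
qed

lift_definition of_real_vec :: "real Matrix.vec \<Rightarrow> nat fsupp"
  is "\<lambda>v i. if i < dim_vec v then complex_of_real (vec_index v i) else 0"
  by (rule finite_subset[of _ "{..<dim_vec _}"]) auto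

lemma inner_of_real_vec:
  assumes "v \<in> carrier_vec n" "w \<in> carrier_vec n"
  shows "inner (of_real_vec v) (of_real_vec w) = scalar_prod v w"
proof -
  have "inner (of_real_vec v) (of_real_vec w) = (\<Sum>i<n. Re (coord (of_real_vec v) i * cnj (coord (of_real_vec w) i)))"
    by (rule inner_fsupp_eq) (use assms in \<open>auto simp: of_real_vec.rep_eq split: if_splits\<close>)
  also have "\<dots> = (\<Sum>i<n. vec_index v i * vec_index w i)"
    by (rule sum.cong) (use assms in \<open>auto simp: of_real_vec.rep_eq\<close>)
  finally show ?thesis using assms by (simp add: scalar_prod_def atLeast0LessThan)
qed

definition max_entangled :: "nat \<Rightarrow> complex Matrix.vec" where
  "max_entangled d = Matrix.vec (d * d) (\<lambda>p. if p div d = p mod d then complex_of_real (1 / sqrt d) else 0)"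

lemma max_entangled_carrier: "max_entangled d \<in> carrier_vec (d * d)"
  by (simp add: max_entangled_def)

lemma max_entangled_index:
  assumes "i < d" "j < d"
  shows "vec_index (max_entangled d) (i * d + j) = (if i = j then complex_of_real (1 / sqrt d) else 0)"
  using bipartite_index[OF assms] by (simp add: max_entangled_def)

lemma cscalar_prod_max_entangled:
  assumes "w \<in> carrier_vec (d * d)"
  shows "w \<bullet>c max_entangled d = (\<Sum>i<d. vec_index w (i * d + i)) * complex_of_real (1 / sqrt d)"
proof -
  have "w \<bullet>c max_entangled d = (\<Sum>p<d * d. vec_index w p * cnj (vec_index (max_entangled d) p))"
    using assms max_entangled_carrier[of d] by (simp add: scalar_prod_def atLeast0LessThan)
  also have "\<dots> = (\<Sum>i<d. \<Sum>j<d. vec_index w (i * d + j) * cnj (vec_index (max_entangled d) (i * d + j)))"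
    by (rule sum_mult_index)
  also have "\<dots> = (\<Sum>i<d. \<Sum>j<d. if j = i then vec_index w (i * d + j) * complex_of_real (1 / sqrt d) else 0)"
    by (intro sum.cong refl) (simp add: max_entangled_index)
  also have "\<dots> = (\<Sum>i<d. vec_index w (i * d + i) * complex_of_real (1 / sqrt d))"
    by (intro sum.cong refl) simp
  finally show ?thesis by (simp only: sum_distrib_right)
qed

lemma max_entangled_norm:
  assumes "d > 0"
  shows "max_entangled d \<bullet>c max_entangled d = 1"
proof -
  have "max_entangled d \<bullet>c max_entangled d = (\<Sum>i<d. complex_of_real (1 / sqrt d)) * complex_of_real (1 / sqrt d)"
    by (simp add: cscalar_prod_max_entangled[OF max_entangled_carrier] max_entangled_index)
  also have "\<dots> = complex_of_real (real d * (1 / sqrt d * (1 / sqrt d)))"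
    by (simp only: sum_constant card_lessThan of_real_mult of_real_of_nat_eq mult.assoc)
  also have "real d * (1 / sqrt d * (1 / sqrt d)) = 1" using assms by simp
  finally show ?thesis by simp
qed

text \<open>The right-hand side is the normalised trace of \<open>X\<close> times the transpose of \<open>Y\<close>.\<close>

lemma max_entangled_kronecker:
  assumes X: "X \<in> carrier_mat d d" and Y: "Y \<in> carrier_mat d d" and d: "d > 0"
  shows "((X \<otimes>\<^sub>K Y) *\<^sub>v max_entangled d) \<bullet>c max_entangled d
    = (\<Sum>i<d. \<Sum>k<d. X $$ (i, k) * Y $$ (i, k)) / of_nat d"
proof -
  let ?c = "complex_of_real (1 / sqrt d)"
  have w: "(X \<otimes>\<^sub>K Y) *\<^sub>v max_entangled d \<in> carrier_vec (d * d)"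
    using X Y by (intro mult_mat_vec_carrier[OF _ max_entangled_carrier]) (simp add: kronecker_def)
  have "vec_index ((X \<otimes>\<^sub>K Y) *\<^sub>v max_entangled d) (i * d + i) = (\<Sum>k<d. X $$ (i, k) * Y $$ (i, k)) * ?c"
    if i: "i < d" for i
  proof -
    have "vec_index ((X \<otimes>\<^sub>K Y) *\<^sub>v max_entangled d) (i * d + i)
      = (\<Sum>k<d. \<Sum>l<d. X $$ (i, k) * Y $$ (i, l) * vec_index (max_entangled d) (k * d + l))"
      by (rule kronecker_mult_vec_index[OF X Y max_entangled_carrier i i])
    also have "\<dots> = (\<Sum>k<d. \<Sum>l<d. if l = k then X $$ (i, k) * Y $$ (i, l) * ?c else 0)"
      by (intro sum.cong refl) (simp add: max_entangled_index)
    also have "\<dots> = (\<Sum>k<d. X $$ (i, k) * Y $$ (i, k) * ?c)"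
      by (intro sum.cong refl) simp
    finally show ?thesis by (simp only: sum_distrib_right)
  qed
  then have "((X \<otimes>\<^sub>K Y) *\<^sub>v max_entangled d) \<bullet>c max_entangled d
      = (\<Sum>i<d. (\<Sum>k<d. X $$ (i, k) * Y $$ (i, k)) * ?c) * ?c"
    unfolding cscalar_prod_max_entangled[OF w] by simp
  also have "\<dots> = (\<Sum>i<d. \<Sum>k<d. X $$ (i, k) * Y $$ (i, k)) * (?c * ?c)"
    by (simp only: sum_distrib_right mult.assoc)
  also have "?c * ?c = 1 / of_nat d"
  proof -
    have "1 / sqrt (real d) * (1 / sqrt (real d)) = 1 / real d" by simp
    then show ?thesis by (metis of_real_1 of_real_divide of_real_mult of_real_of_nat_eq)
  qed
  finally show ?thesis by simp
qed

lemma hermitian_transpose: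
  assumes A: "A \<in> carrier_mat d d" and h: "hermitian A"
  shows "hermitian (transpose_mat A)"
  unfolding hermitian_def
proof (rule eq_matI)
  have At: "transpose_mat A \<in> carrier_mat d d" using A by simp
  fix i j assume "i < dim_row (transpose_mat A)" "j < dim_col (transpose_mat A)"
  then have ij: "i < d" "j < d" using A by auto
  have "mat_adjoint A $$ (j, i) = A $$ (j, i)" using h by (simp add: hermitian_def)
  then show "mat_adjoint (transpose_mat A) $$ (i, j) = transpose_mat A $$ (i, j)"
    using hermitian_entry[OF A ij(2,1)] hermitian_entry[OF At ij] A ij by simp
qed (use A in \<open>simp_all add: mat_adjoint_def\<close>)

lemma local_dimension_attained:
  fixes C :: "real ^ 'n ^ 'm"
  assumes ext: "C extreme_point_of Cor"
  shows "\<exists>\<psi> X Y. tensor_operator_rep (2 ^ (rank C div 2)) C \<psi> X Y"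
proof -
  have "C \<in> Cor" using ext by (simp add: extreme_point_of_def)
  then obtain n x y where x: "\<And>s. x s \<in> carrier_vec n" "\<And>s. scalar_prod (x s) (x s) = 1"
    and y: "\<And>t. y t \<in> carrier_vec n" "\<And>t. scalar_prod (y t) (y t) = 1"
    and C: "\<And>s t. C $ s $ t = scalar_prod (x s) (y t)"
    unfolding Cor_def by blast
  interpret extreme_system C "\<lambda>s. of_real_vec (x s)" "\<lambda>t. of_real_vec (y t)"
    by unfold_locales
      (use ext x y C in \<open>auto simp: inner_of_real_vec[OF x(1) x(1)] inner_of_real_vec[OF y(1) y(1)]
        inner_of_real_vec[OF x(1) y(1)] norm_eq_sqrt_inner\<close>)
  let ?r = "rank C"
  obtain u :: "nat \<Rightarrow> nat fsupp"
    where ux: "\<And>s. of_real_vec (x s) = (\<Sum>i<?r. inner (of_real_vec (x s)) (u i) *\<^sub>R u i)"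
    and uy: "\<And>t. of_real_vec (y t) = (\<Sum>i<?r. inner (of_real_vec (y t)) (u i) *\<^sub>R u i)"
    by (rule orthonormal_frame) (rule that)
  define \<xi> where "\<xi> s i = inner (of_real_vec (x s)) (u i)" for s i
  define \<eta> where "\<eta> t i = inner (of_real_vec (y t)) (u i)" for t i
  have expand: "inner v w = (\<Sum>i<?r. inner v (u i) * inner w (u i))"
    if "v = (\<Sum>i<?r. inner v (u i) *\<^sub>R u i)" for v w
  proof -
    have "inner v w = inner (\<Sum>i<?r. inner v (u i) *\<^sub>R u i) w" using that by simp
    then show ?thesis by (simp only: inner_sum_left inner_scaleR_left inner_commute[of w])
  qed
  have x1: "(\<Sum>i<?r. \<xi> s i * \<xi> s i) = 1" for s
    using expand[OF ux, of s "of_real_vec (x s)"] inner_of_real_vec[OF x(1) x(1)] x(2) by (simp add: \<xi>_def)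
  have y1: "(\<Sum>i<?r. \<eta> t i * \<eta> t i) = 1" for t
    using expand[OF uy, of t "of_real_vec (y t)"] inner_of_real_vec[OF y(1) y(1)] y(2) by (simp add: \<eta>_def)
  have Cxy: "C $ s $ t = (\<Sum>i<?r. \<xi> s i * \<eta> t i)" for s t
    using expand[OF ux, of s "of_real_vec (y t)"] inner_of_real_vec[OF x(1) y(1)] by (simp add: C \<xi>_def \<eta>_def)
  define D :: nat where "D = 2 ^ (?r div 2)"
  have D0: "D > 0" by (simp add: D_def)
  obtain g :: "nat \<Rightarrow> nat \<Rightarrow> nat \<Rightarrow> complex" where
    g: "\<forall>i<2 * (?r div 2) + 1. \<forall>p q. g i q p = cnj (g i p q)"
      "\<forall>i<2 * (?r div 2) + 1. \<forall>j<2 * (?r div 2) + 1. \<forall>p<D. \<forall>q<D.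
        fmult D (g i) (g j) p q + fmult D (g j) (g i) p q = (if i = j \<and> p = q then 2 else 0)"
    using clifford_generators[of "?r div 2"] unfolding D_def by blast
  have le: "i < 2 * (?r div 2) + 1" if "i < ?r" for i using that by presburger
  interpret W: clifford_family D ?r g
    by unfold_locales (use g le in blast)+
  define X where "X s = W.clifford_vector (\<xi> s)" for s
  define Y where "Y t = transpose_mat (W.clifford_vector (\<eta> t))" for t
  have Xc: "X s \<in> carrier_mat D D" for s unfolding X_def by (rule W.clifford_vector_carrier)
  have Yc: "Y t \<in> carrier_mat D D" for t unfolding Y_def using W.clifford_vector_carrier by simp
  have "tensor_operator_rep D C (max_entangled D) X Y"
    unfolding tensor_operator_rep_def
  proof (intro conjI allI)
    show "max_entangled D \<in> carrier_vec (D * D)" by (rule max_entangled_carrier)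
    show "max_entangled D \<bullet>c max_entangled D = 1" by (rule max_entangled_norm[OF D0])
    fix s t
    show "X s \<in> carrier_mat D D" "Y t \<in> carrier_mat D D" by (rule Xc Yc)+
    show "hermitian (X s)" unfolding X_def by (rule W.clifford_vector_hermitian)
    show "hermitian (Y t)" unfolding Y_def
      by (rule hermitian_transpose[OF W.clifford_vector_carrier W.clifford_vector_hermitian])
    show "spectrum (X s) \<subseteq> complex_of_real ` {-1..1}"
      by (rule spectrum_of_involution[OF Xc]) (simp add: X_def W.clifford_vector_square x1)
    show "spectrum (Y t) \<subseteq> complex_of_real ` {-1..1}"
    proof (rule spectrum_of_involution[OF Yc])
      let ?W = "W.clifford_vector (\<eta> t)"
      have "Y t * Y t = transpose_mat (?W * ?W)"
        unfolding Y_def by (rule transpose_mult[symmetric]) (rule W.clifford_vector_carrier)+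
      then show "Y t * Y t = 1\<^sub>m D" by (simp add: W.clifford_vector_square y1)
    qed
    have "((X s \<otimes>\<^sub>K Y t) *\<^sub>v max_entangled D) \<bullet>c max_entangled D
        = (\<Sum>i<D. \<Sum>k<D. X s $$ (i, k) * Y t $$ (i, k)) / of_nat D"
      by (rule max_entangled_kronecker[OF Xc Yc D0])
    also have "(\<Sum>i<D. \<Sum>k<D. X s $$ (i, k) * Y t $$ (i, k))
        = (\<Sum>i<D. \<Sum>k<D. W.clifford_vector (\<xi> s) $$ (i, k) * W.clifford_vector (\<eta> t) $$ (k, i))"
      using carrier_matD[OF W.clifford_vector_carrier] by (intro sum.cong refl) (simp add: X_def Y_def)
    also have "\<dots> = of_nat D * complex_of_real (C $ s $ t)"
      by (simp only: W.clifford_vector_trace Cxy)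
    finally show "complex_of_real (C $ s $ t) = ((X s \<otimes>\<^sub>K Y t) *\<^sub>v max_entangled D) \<bullet>c max_entangled D"
      using D0 by simp
  qed
  then show ?thesis unfolding D_def by blast
qed

theorem corollary4p5:
  fixes C :: "real ^ 'n ^ 'm" and r :: nat
  assumes "C extreme_point_of Cor" and "r = rank C"
  shows "(\<exists>\<psi> X Y. tensor_operator_rep (2 ^ (r div 2)) C \<psi> X Y) \<and>
         (\<forall>d \<psi> X Y. tensor_operator_rep d C \<psi> X Y \<longrightarrow> 2 ^ (r div 2) \<le> d)"
  using local_dimension_attained[OF assms(1)] local_dimension_lower_bound[OF assms(1)] assms(2) by blast

end
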